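(* Let $k\ge 7$ and let $G$ be a planar (finite simple) graph with maximum degree $\Delta\le k$. If $G$ contains no 5-net, then $\operatorname{col}(T(G))\le k+2$.
   Context: A cycle of length $k$ in $G$ is a $k$-net if it has at least one chord in $G$. The total graph $T(G)$ has vertex set $V(G)\cup E(G)$, two elements adjacent iff they are adjacent or incident in $G$. The coloring number $\operatorname{col}(H)$ is the smallest integer $m$ such that some ordering of $V(H)$ has each vertex with at most $m-1$ neighbors among vertices of smaller index. *)

theory Defs
  imports "HOL-Analysis.Analysis"
begin

text \<open>A graph is a pair of a vertex set and a set of edges, each edge being the set of its two
  endvertices.\<close>

type_synonym 'a graph = "'a set \<times> 'a set set"

abbreviation verts :: "'a graph \<Rightarrow> 'a set" where "verts G \<equiv> fst G"
abbreviation edges :: "'a graph \<Rightarrow> 'a set set" where "edges G \<equiv> snd G"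

definition finite_simple_graph :: "'a graph \<Rightarrow> bool" where
  "finite_simple_graph G \<longleftrightarrow>
     finite (verts G) \<and> (\<forall>e\<in>edges G. e \<subseteq> verts G \<and> card e = 2)"

definition adj :: "'a graph \<Rightarrow> 'a \<Rightarrow> 'a \<Rightarrow> bool" where
  "adj G u v \<longleftrightarrow> {u, v} \<in> edges G"

definition degree :: "'a graph \<Rightarrow> 'a \<Rightarrow> nat" where
  "degree G v = card {u \<in> verts G. adj G v u}"

text \<open>The element 0 only matters for the graph without vertices.\<close>

definition max_degree :: "'a graph \<Rightarrow> nat" where
  "max_degree G = Max (insert 0 (degree G ` verts G))"

text \<open>A drawing in the plane (identified with the complex numbers) places vertices at distinct
  points and draws each edge as a simple arc between its endvertices, such that an arc contains no
  further vertex and two arcs meet at most in common endvertices.\<close>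

definition plane_drawing :: "'a graph \<Rightarrow> ('a \<Rightarrow> complex) \<Rightarrow> ('a set \<Rightarrow> real \<Rightarrow> complex) \<Rightarrow> bool" where
  "plane_drawing G p \<gamma> \<longleftrightarrow>
     inj_on p (verts G) \<and>
     (\<forall>e\<in>edges G. arc (\<gamma> e) \<and> {pathstart (\<gamma> e), pathfinish (\<gamma> e)} = p ` e \<and>
        path_image (\<gamma> e) \<inter> p ` verts G \<subseteq> p ` e) \<and>
     (\<forall>e\<in>edges G. \<forall>f\<in>edges G. e \<noteq> f \<longrightarrow> path_image (\<gamma> e) \<inter> path_image (\<gamma> f) \<subseteq> p ` (e \<inter> f))"

definition planar :: "'a graph \<Rightarrow> bool" where
  "planar G \<longleftrightarrow> (\<exists>p \<gamma>. plane_drawing G p \<gamma>)"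

text \<open>A cycle is given by the list of its vertices in cyclic order.\<close>

definition cycle_edges :: "'a list \<Rightarrow> 'a set set" where
  "cycle_edges c = {{c ! i, c ! (Suc i mod length c)} | i. i < length c}"

definition is_cycle :: "'a graph \<Rightarrow> 'a list \<Rightarrow> bool" where
  "is_cycle G c \<longleftrightarrow>
     3 \<le> length c \<and> distinct c \<and> set c \<subseteq> verts G \<and> cycle_edges c \<subseteq> edges G"

definition is_chord :: "'a graph \<Rightarrow> 'a list \<Rightarrow> 'a set \<Rightarrow> bool" where
  "is_chord G c e \<longleftrightarrow> e \<in> edges G \<and> e \<subseteq> set c \<and> e \<notin> cycle_edges c"

definition is_net :: "nat \<Rightarrow> 'a graph \<Rightarrow> 'a list \<Rightarrow> bool" where
  "is_net k G c \<longleftrightarrow> is_cycle G c \<and> length c = k \<and> (\<exists>e. is_chord G c e)"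

definition total_graph :: "'a graph \<Rightarrow> ('a + 'a set) graph" where
  "total_graph G =
     (Inl ` verts G \<union> Inr ` edges G,
      {{Inl u, Inl v} | u v. adj G u v} \<union>
      {{Inl v, Inr e} | v e. e \<in> edges G \<and> v \<in> e} \<union>
      {{Inr e, Inr f} | e f. e \<in> edges G \<and> f \<in> edges G \<and> e \<noteq> f \<and> e \<inter> f \<noteq> {}})"

text \<open>The integer subtraction makes the bound unsatisfiable for \<open>m = 0\<close> unless the graph has no
  vertices.\<close>

definition ordering_bound :: "'a graph \<Rightarrow> ('a \<Rightarrow> nat) \<Rightarrow> nat \<Rightarrow> bool" where
  "ordering_bound H r m \<longleftrightarrow>
     bij_betw r (verts H) {..<card (verts H)} \<and>
     (\<forall>v\<in>verts H. int (card {u \<in> verts H. adj H v u \<and> r u < r v}) \<le> int m - 1)"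

definition col :: "'a graph \<Rightarrow> nat" where
  "col H = (LEAST m. \<exists>r. ordering_bound H r m)"

end

theory Submission
  imports Defs
begin

text \<open>In the total graph, a vertex \<open>u\<close> of degree at most 4 has degree at most 8, and an edge \<open>uv\<close> has
  degree \<open>d(u) + d(v) - 1\<close> once \<open>u\<close> is removed. So if \<open>d(u) \<le> 4\<close> and \<open>d(u) + d(v) \<le> k + 2\<close>, an
  ordering for \<open>G - uv\<close> with \<open>u\<close> deleted can be continued by \<open>uv\<close> and then \<open>u\<close>. It remains to find
  such an edge when the minimum degree is at least 3. Otherwise every neighbour of a 3-vertex has
  degree at least 7 and every neighbour of a 4-vertex degree at least 6. Take a vertex \<open>v0\<close> and a
  component \<open>C\<close> of \<open>G - v0\<close> with \<open>C\<close> as small as possible. Then the graph on \<open>C\<close> and \<open>v0\<close> is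
  2-connected, so it arises from a circuit by adding ears, and the Jordan curve theorem shows step
  by step that its faces are bounded by circuits, that every edge lies on two of them, and that
  Euler's formula holds. Without 5-nets no triangle shares an edge with a face of length 4, and
  triangles hardly share edges with each other. Discharging with initial charges \<open>d(v) - 4\<close> and
  \<open>|f| - 4\<close>, of total -8, then leaves all charges nonnegative except that of \<open>v0\<close>, which stays
  above -8.\<close>

section \<open>Theta graphs in the plane\<close>

text \<open>The end block serves two purposes. It is 2-connected, so face boundaries are circuits
  and patterns of short faces really give 5-cycles. And every vertex of \<open>C\<close> keeps its
  degree from \<open>G\<close>, so the absence of a light edge can be used everywhere but at
  \<open>v0\<close>. In exchange \<open>v0\<close> may have any degree, which is affordable because
  the total charge -8 leaves that much room at a single vertex. The tight spot of the discharging is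
  a vertex of degree 7, whose charge 3 allows 3/7 per edge. A 3-vertex asks 1/3 of each neighbour,
  and a triangle may ask 2/5 of a vertex. The larger demand 2/5 comes, away from \<open>v0\<close>,
  only from a triangle that is one of three around a 3-vertex. Splitting the demand of a triangle
  unevenly between its two edges at the paying vertex therefore keeps every edge below 3/7. Both
  kinds of light edge have degree sum at most 9, which is \<open>k + 2\<close> for
  \<open>k = 7\<close>; likewise the at most 8 neighbours of \<open>u\<close> in the total graph fit
  into \<open>k + 1\<close>.\<close>

definition arc_between :: "complex \<Rightarrow> complex \<Rightarrow> complex set \<Rightarrow> bool" where
  "arc_between a b A \<longleftrightarrow> (\<exists>g. arc g \<and> pathstart g = a \<and> pathfinish g = b \<and> path_image g = A)"

lemma arc_between_sym: "arc_between a b A \<Longrightarrow> arc_between b a A"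
  unfolding arc_between_def
  by (metis arc_reversepath path_image_reversepath pathfinish_reversepath pathstart_reversepath)

lemma arc_between_ends: "arc_between a b A \<Longrightarrow> a \<in> A \<and> b \<in> A \<and> a \<noteq> b"
  unfolding arc_between_def using arc_distinct_ends by fastforce

text \<open>The open arc is the image of an open interval that is dense in the closed one, hence the
  inclusion in the closure. That inclusion later puts the ends of an ear on the frontier of the face
  containing its interior.\<close>

lemma arc_between_interior:
  assumes "arc_between a b A"
  shows "connected (A - {a,b})" "A - {a,b} \<noteq> {}" "compact A" "A \<subseteq> closure (A - {a,b})"
proof -
  obtain g where g: "arc g" "pathstart g = a" "pathfinish g = b" "path_image g = A"
    using assms unfolding arc_between_def by blast
  have sp: "simple_path g" by (simp add: g arc_imp_simple_path)
  show "connected (A - {a,b})" using connected_simple_path_endless[OF sp] g by simp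
  show "A - {a,b} \<noteq> {}" using nonempty_simple_path_endless[OF sp] g by simp
  show "compact A" using compact_arc_image g by blast
  have e: "A - {a,b} = g ` {0<..<1}" using simple_path_endless[OF sp] g by simp
  have "g ` closure {0<..<1} \<subseteq> closure (g ` {0<..<1})"
    by (rule image_closure_subset) (use g in \<open>auto simp: arc_def path_def closure_subset\<close>)
  then show "A \<subseteq> closure (A - {a,b})" using e g by (simp add: path_image_def)
qed

lemma arc_between_join:
  assumes "arc_between a b A" "arc_between b c B" "A \<inter> B \<subseteq> {b}"
  shows "arc_between a c (A \<union> B)"
proof -
  obtain g h where "arc g" "pathstart g = a" "pathfinish g = b" "path_image g = A"
    "arc h" "pathstart h = b" "pathfinish h = c" "path_image h = B"
    using assms unfolding arc_between_def by blast
  then show ?thesis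
    unfolding arc_between_def using assms(3)
    by (intro exI[of _ "g +++ h"]) (simp add: arc_join path_image_join)
qed

lemma arc_between_jordan:
  assumes "arc_between a b A" "arc_between a b B" "A \<inter> B = {a,b}"
  shows "inside (A \<union> B) \<noteq> {}" "open (inside (A \<union> B))" "connected (inside (A \<union> B))"
    "outside (A \<union> B) \<noteq> {}" "open (outside (A \<union> B))" "connected (outside (A \<union> B))"
    "bounded (inside (A \<union> B))" "\<not> bounded (outside (A \<union> B))"
    "inside (A \<union> B) \<inter> outside (A \<union> B) = {}" "inside (A \<union> B) \<union> outside (A \<union> B) = - (A \<union> B)"
    "frontier (inside (A \<union> B)) = A \<union> B" "frontier (outside (A \<union> B)) = A \<union> B"
proof -
  obtain g h where gh: "arc g" "pathstart g = a" "pathfinish g = b" "path_image g = A"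
    "arc h" "pathstart h = a" "pathfinish h = b" "path_image h = B"
    using assms unfolding arc_between_def by blast
  let ?c = "g +++ reversepath h"
  have "simple_path ?c" "pathfinish ?c = pathstart ?c" "path_image ?c = A \<union> B"
    using gh assms(3) by (auto simp: simple_path_join_loop_eq path_image_join arc_reversepath)
  then show "inside (A \<union> B) \<noteq> {}" "open (inside (A \<union> B))" "connected (inside (A \<union> B))"
    "outside (A \<union> B) \<noteq> {}" "open (outside (A \<union> B))" "connected (outside (A \<union> B))"
    "bounded (inside (A \<union> B))" "\<not> bounded (outside (A \<union> B))"
    "inside (A \<union> B) \<inter> outside (A \<union> B) = {}" "inside (A \<union> B) \<union> outside (A \<union> B) = - (A \<union> B)"
    "frontier (inside (A \<union> B)) = A \<union> B" "frontier (outside (A \<union> B)) = A \<union> B"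
    using Jordan_inside_outside[of ?c] by auto
qed

lemma components_unique:
  fixes S :: "'a::real_normed_vector set"
  assumes "pairwise disjnt \<A>" "\<And>X. X \<in> \<A> \<Longrightarrow> open X \<and> connected X \<and> X \<noteq> {}" "\<Union>\<A> = S"
  shows "components S = \<A>"
proof -
  have "open S" using assms by auto
  show ?thesis
    by (rule connected_disjoint_Union_open_unique)
      (use assms \<open>open S\<close> pairwise_disjoint_components[of S] in \<open>auto simp: open_components
        in_components_connected in_components_nonempty disjnt_def[abs_def]\<close>)
qed

lemma components_jordan:
  assumes "arc_between a b A" "arc_between a b B" "A \<inter> B = {a,b}"
  shows "components (- (A \<union> B)) = {inside (A \<union> B), outside (A \<union> B)}"
proof (rule components_unique)
  note j = arc_between_jordan[OF assms]
  show "pairwise disjnt {inside (A \<union> B), outside (A \<union> B)}"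
    using j(9) by (simp add: pairwise_insert disjnt_def Int_commute)
  show "\<Union> {inside (A \<union> B), outside (A \<union> B)} = - (A \<union> B)" using j(10) by simp
qed (use arc_between_jordan[OF assms] in auto)

lemma arc_between_split_inside:
  assumes "arc_between a b A" "arc_between a b B" "arc_between a b C"
    and "A \<inter> B = {a,b}" "A \<inter> C = {a,b}" "B \<inter> C = {a,b}"
    and "C \<inter> inside (A \<union> B) \<noteq> {}"
  shows "inside (A \<union> C) \<inter> inside (B \<union> C) = {}"
    "inside (A \<union> C) \<union> inside (B \<union> C) \<union> (C - {a,b}) = inside (A \<union> B)"
proof -
  obtain f g h where fg: "arc f" "pathstart f = a" "pathfinish f = b" "path_image f = A"
    "arc g" "pathstart g = a" "pathfinish g = b" "path_image g = B"
    "arc h" "pathstart h = a" "pathfinish h = b" "path_image h = C"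
    using assms(1-3) unfolding arc_between_def by blast
  then have "a \<noteq> b" using arc_distinct_ends by blast
  then have "inside (A \<union> C) \<inter> inside (B \<union> C) = {} \<and>
    inside (A \<union> C) \<union> inside (B \<union> C) \<union> (C - {a,b}) = inside (A \<union> B)"
    using split_inside_simple_closed_curve[of f a b g h]
    using fg assms(4-) by (metis arc_imp_simple_path)
  then show "inside (A \<union> C) \<inter> inside (B \<union> C) = {}"
    "inside (A \<union> C) \<union> inside (B \<union> C) \<union> (C - {a,b}) = inside (A \<union> B)" by auto
qed

text \<open>If no arc lay inside the curve formed by the other two, a point inside \<open>A \<union> B\<close> and a far away
  point would be separated neither by \<open>A \<union> C\<close> nor by \<open>B \<union> C\<close>, so by Janiszewski not by the
  union.\<close>

lemma theta_one_inside:
  assumes A: "arc_between a b A" and B: "arc_between a b B" and C: "arc_between a b C"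
    and AB: "A \<inter> B = {a,b}" and AC: "A \<inter> C = {a,b}" and BC: "B \<inter> C = {a,b}"
  shows "A \<inter> inside (B \<union> C) \<noteq> {} \<or> B \<inter> inside (A \<union> C) \<noteq> {} \<or> C \<inter> inside (A \<union> B) \<noteq> {}"
proof (rule ccontr)
  assume "\<not> ?thesis"
  then have no: "A \<inter> inside (B \<union> C) = {}" "B \<inter> inside (A \<union> C) = {}" "C \<inter> inside (A \<union> B) = {}"
    by auto
  note jAB = arc_between_jordan[OF A B AB]
  note jAC = arc_between_jordan[OF A C AC]
  note jBC = arc_between_jordan[OF B C BC]
  \<comment> \<open>\<open>X\<close> and \<open>Y\<close> stand for \<open>A\<close> and
    \<open>B\<close> in either order. The connected set \<open>inside (A \<union> B)\<close> misses
    the curve \<open>X \<union> C\<close>. Were it inside that curve, then so would be the inner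
    points of \<open>Y\<close>, which lie on its frontier, contrary to the assumption on
    \<open>Y\<close>.\<close>
  have sub: "inside (A \<union> B) \<subseteq> outside (X \<union> C)"
    if X: "X \<inter> inside (A \<union> B) = {}" and Y: "Y \<inter> inside (X \<union> C) = {}" "A \<union> B = X \<union> Y"
      "inside (X \<union> C) \<union> outside (X \<union> C) = - (X \<union> C)" "frontier (inside (X \<union> C)) = X \<union> C"
      "Y - {a,b} \<noteq> {}" "X \<inter> Y = {a,b}" "Y \<inter> C = {a,b}"
      "open (inside (X \<union> C))" "open (outside (X \<union> C))" "inside (X \<union> C) \<inter> outside (X \<union> C) = {}" for X Y
  proof (rule ccontr)
    assume n: "\<not> ?thesis"
    have i: "inside (A \<union> B) \<subseteq> inside (X \<union> C) \<union> outside (X \<union> C)"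
      using X no(3) Y(3) by auto
    have "inside (A \<union> B) \<subseteq> inside (X \<union> C)"
      using connectedD[OF jAB(3) Y(8,9)] i n Y(10) by blast
    then have "closure (inside (A \<union> B)) \<subseteq> closure (inside (X \<union> C))" by (rule closure_mono)
    then have "Y \<subseteq> inside (X \<union> C) \<union> (X \<union> C)"
      using jAB(11) Y(2,4) closure_Un_frontier by blast
    moreover obtain y where "y \<in> Y" "y \<notin> {a,b}" using Y(5) by blast
    moreover have "y \<notin> X" "y \<notin> C" using \<open>y \<in> Y\<close> \<open>y \<notin> {a,b}\<close> Y(6,7) by blast+
    ultimately show False using Y(1) by blast
  qed
  have ov: "A \<inter> inside (A \<union> B) = {}" "B \<inter> inside (A \<union> B) = {}"
    using inside_no_overlap[of "A \<union> B"] by blast+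
  have s1: "inside (A \<union> B) \<subseteq> outside (A \<union> C)"
    by (rule sub[of A B]) (use ov no jAC arc_between_interior(2)[OF B] AB BC in simp_all)
  have s2: "inside (A \<union> B) \<subseteq> outside (B \<union> C)"
    by (rule sub[of B A]) (use ov no jBC arc_between_interior(2)[OF A] AB AC in \<open>simp_all add: Int_commute Un_commute\<close>)
  obtain x where x: "x \<in> inside (A \<union> B)" using jAB by auto
  have cpt: "compact A" "compact B" "compact C" using A B C arc_between_interior(3) by auto
  have "bounded (inside (A \<union> B) \<union> inside (A \<union> C) \<union> inside (B \<union> C) \<union> A \<union> B \<union> C)"
    using jAB(7) jAC(7) jBC(7) cpt compact_imp_bounded by auto
  then obtain y where "y \<notin> inside (A \<union> B) \<union> inside (A \<union> C) \<union> inside (B \<union> C) \<union> A \<union> B \<union> C"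
    by (metis UNIV_eq_I not_bounded_UNIV)
  then have y: "y \<in> outside (A \<union> B)" "y \<in> outside (A \<union> C)" "y \<in> outside (B \<union> C)"
    using jAB(10) jAC(10) jBC(10) by blast+
  \<comment> \<open>Janiszewski needs the two separating sets to meet in a connected set; here they
    meet exactly in the arc \<open>C\<close>.\<close>
  have "connected_component (- ((A \<union> C) \<union> (B \<union> C))) x y"
  proof (rule Janiszewski)
    have "(A \<union> C) \<inter> (B \<union> C) = C" using AB AC BC by auto
    moreover have "connected C" using C unfolding arc_between_def using connected_arc_image by blast
    ultimately show "connected ((A \<union> C) \<inter> (B \<union> C))" by simp
    show "compact (A \<union> C)" "closed (B \<union> C)" using cpt by (auto simp: compact_imp_closed)
    show "connected_component (- (A \<union> C)) x y"
      unfolding connected_component_def using s1 x y jAC(6,10) by blast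
    show "connected_component (- (B \<union> C)) x y"
      unfolding connected_component_def using s2 x y jBC(6,10) by blast
  qed
  then have "connected_component (- (A \<union> B)) x y"
    by (rule connected_component_of_subset) auto
  then have "y \<in> inside (A \<union> B)" using x inside_same_component by blast
  then show False using y(1) jAB(9) by blast
qed

text \<open>The arc \<open>B\<close> runs inside the curve \<open>A \<union> C\<close> and cuts that
  inside into two parts. Taking complements turns this into a statement on how \<open>C\<close> cuts
  the outside of \<open>A \<union> B\<close>: one part is unbounded, the other is the inside of a
  curve.\<close>

lemma theta_split_outside:
  assumes A: "arc_between a b A" and B: "arc_between a b B" and C: "arc_between a b C"
    and AB: "A \<inter> B = {a,b}" and AC: "A \<inter> C = {a,b}" and BC: "B \<inter> C = {a,b}"
    and "B \<inter> inside (A \<union> C) \<noteq> {}"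
  shows "outside (A \<union> C) \<inter> inside (B \<union> C) = {}"
    "outside (A \<union> C) \<union> inside (B \<union> C) = outside (A \<union> B) - C"
proof -
  have CB: "C \<inter> B = {a,b}" using BC by blast
  note s = arc_between_split_inside[OF A C B AC AB CB assms(7)]
  have BC': "C \<union> B = B \<union> C" by blast
  note s = s[unfolded BC']
  have i: "inside (B \<union> C) \<subseteq> inside (A \<union> C)" using s(2) by blast
  show 1: "outside (A \<union> C) \<inter> inside (B \<union> C) = {}"
    using i inside_Int_outside[of "A \<union> C"] by blast
  have u: "inside (A \<union> C) \<union> outside (A \<union> C) = - (A \<union> C)" "inside (A \<union> B) \<union> outside (A \<union> B) = - (A \<union> B)"
    "inside (A \<union> C) \<inter> outside (A \<union> C) = {}" "inside (A \<union> B) \<inter> outside (A \<union> B) = {}"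
    using arc_between_jordan[OF A C AC] arc_between_jordan[OF A B AB] by auto
  have nb: "inside (B \<union> C) \<inter> (B \<union> C) = {}" by simp
  have ends: "a \<in> A" "b \<in> A" using arc_between_ends[OF A] by auto
  show "outside (A \<union> C) \<union> inside (B \<union> C) = outside (A \<union> B) - C"
  proof (intro equalityI subsetI)
    fix x assume "x \<in> outside (A \<union> C) \<union> inside (B \<union> C)"
    then consider "x \<in> outside (A \<union> C)" | "x \<in> inside (B \<union> C)" by blast
    then show "x \<in> outside (A \<union> B) - C"
    proof cases
      case 1
      then have "x \<notin> A" "x \<notin> C" "x \<notin> inside (A \<union> C)" using u(1,3) by blast+
      moreover from this have "x \<notin> inside (A \<union> B)" "x \<notin> B" using s(2) ends by blast+
      ultimately show ?thesis using u(2) by blast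
    next
      case 2
      then have "x \<in> inside (A \<union> C)" "x \<notin> B" "x \<notin> C" using i nb by blast+
      moreover from this have "x \<notin> A" using u(1) by blast
      moreover have "x \<notin> inside (A \<union> B)" using s(1) 2 by blast
      ultimately show ?thesis using u(2) by blast
    qed
  next
    fix x assume "x \<in> outside (A \<union> B) - C"
    then have "x \<notin> A" "x \<notin> B" "x \<notin> C" "x \<notin> inside (A \<union> B)" using u(2,4) by blast+
    then show "x \<in> outside (A \<union> C) \<union> inside (B \<union> C)" using u(1) s(2) by blast
  qed
qed

text \<open>The topological core of adding an ear \<open>C\<close> within a face \<open>R\<close>.
  If \<open>R\<close> is the outside, \<open>theta_one_inside\<close> leaves two symmetric cases,
  according to which of \<open>A\<close> and \<open>B\<close> is enclosed by the other two
  arcs.\<close>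

lemma theta_split:
  assumes A: "arc_between a b A" and B: "arc_between a b B" and C: "arc_between a b C"
    and AB: "A \<inter> B = {a,b}" and AC: "A \<inter> C = {a,b}" and BC: "B \<inter> C = {a,b}"
    and R: "R \<in> components (- (A \<union> B))" "C - {a,b} \<subseteq> R"
  obtains R1 R2 where "R1 \<inter> R2 = {}" "R1 \<union> R2 = R - C" "open R1" "open R2" "connected R1" "connected R2"
    "R1 \<noteq> {}" "R2 \<noteq> {}" "frontier R1 = A \<union> C" "frontier R2 = B \<union> C"
proof -
  note jAB = arc_between_jordan[OF A B AB]
  note jAC = arc_between_jordan[OF A C AC]
  note jBC = arc_between_jordan[OF B C BC]
  have BA: "B \<inter> A = {a,b}" "C \<inter> A = {a,b}" "C \<inter> B = {a,b}" using AB AC BC by auto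
  have Un: "B \<union> A = A \<union> B" "C \<union> A = A \<union> C" "C \<union> B = B \<union> C" by auto
  have ne: "C - {a,b} \<noteq> {}" by (rule arc_between_interior(2)[OF C])
  from R components_jordan[OF A B AB] consider "R = inside (A \<union> B)" | "R = outside (A \<union> B)" by auto
  then show ?thesis
  proof cases
    case 1
    then have "C \<inter> inside (A \<union> B) \<noteq> {}" using R(2) ne by blast
    note s = arc_between_split_inside[OF A B C AB AC BC this]
    have "inside (A \<union> C) \<inter> C = {}" "inside (B \<union> C) \<inter> C = {}"
      using inside_no_overlap[of "A \<union> C"] inside_no_overlap[of "B \<union> C"] by blast+
    moreover have "a \<notin> inside (A \<union> B)" "b \<notin> inside (A \<union> B)"
      using inside_no_overlap[of "A \<union> B"] arc_between_ends[OF A] by blast+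
    ultimately have e: "inside (A \<union> C) \<union> inside (B \<union> C) = inside (A \<union> B) - C"
      using s(2) by blast
    show ?thesis
      by (rule that[of "inside (A \<union> C)" "inside (B \<union> C)"])
        (use s jAC jBC 1 e in \<open>simp_all\<close>)
  next
    case 2
    then have "C \<inter> inside (A \<union> B) = {}" using R(2) jAB(9) inside_no_overlap[of "A \<union> B"] 
      arc_between_ends[OF A] by blast
    then consider "B \<inter> inside (A \<union> C) \<noteq> {}" | "A \<inter> inside (B \<union> C) \<noteq> {}"
      using theta_one_inside[OF A B C AB AC BC] by blast
    then show ?thesis
    proof cases
      case 1
      note s = theta_split_outside[OF A B C AB AC BC 1]
      show ?thesis
        by (rule that[of "outside (A \<union> C)" "inside (B \<union> C)"]) (use s jAC jBC 2 in simp_all)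
    next
      case c: 2
      note s = theta_split_outside[OF B A C BA(1) BC AC c]
      show ?thesis
        by (rule that[of "inside (A \<union> C)" "outside (B \<union> C)"])
          (use s jAC jBC 2 Un in \<open>simp_all add: Int_commute Un_commute[of "inside _" "outside _"]\<close>)
    qed
  qed
qed

section \<open>Circuits and facial systems\<close>

fun path_edges :: "'a list \<Rightarrow> 'a set set" where
  "path_edges (x # y # zs) = insert {x, y} (path_edges (y # zs))"
| "path_edges _ = {}"

lemma path_edges_append: "path_edges (xs @ x # ys) = path_edges (xs @ [x]) \<union> path_edges (x # ys)"
proof (induction xs)
  case (Cons a xs)
  then show ?case by (cases xs) auto
qed simp

lemma path_edges_rev: "path_edges (rev xs) = path_edges xs"
proof (induction xs rule: path_edges.induct)
  case (1 x y zs)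
  then show ?case using path_edges_append[of "rev zs" y "[x]"] by (auto simp: insert_commute)
qed auto

lemma Union_path_edges: "2 \<le> length xs \<Longrightarrow> \<Union>(path_edges xs) = set xs"
proof (induction xs rule: path_edges.induct)
  case (1 x y zs)
  then show ?case by (cases zs) auto
qed auto

lemma Union_path_edges_subset: "\<Union>(path_edges xs) \<subseteq> set xs"
  by (induction xs rule: path_edges.induct) auto

lemma finite_path_edges [simp]: "finite (path_edges xs)"
  by (induction xs rule: path_edges.induct) auto

lemma card_path_edges: "distinct (x # xs) \<Longrightarrow> card (path_edges (x # xs)) = length xs"
proof (induction xs arbitrary: x)
  case (Cons y xs)
  have "{x, y} \<notin> path_edges (y # xs)"
    using Cons.prems Union_path_edges_subset[of "y # xs"] by auto
  then show ?case using Cons by simp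
qed simp

lemma card2_path_edges: "distinct xs \<Longrightarrow> e \<in> path_edges xs \<Longrightarrow> card e = 2"
  by (induction xs rule: path_edges.induct) auto

lemma path_edges_at_start:
  assumes "distinct (a # xs)" "xs \<noteq> []"
  shows "{e \<in> path_edges (a # xs). a \<in> e} = {{a, hd xs}}"
  using assms Union_path_edges_subset[of xs] by (cases xs) auto

lemma path_edges_at_end:
  assumes "distinct (xs @ [b])" "xs \<noteq> []"
  shows "{e \<in> path_edges (xs @ [b]). b \<in> e} = {{b, last xs}}"
  using path_edges_at_start[of b "rev xs"] assms path_edges_rev[of "xs @ [b]"]
  by (auto simp: hd_rev)

text \<open>Used to exclude a common edge of two paths that share only their ends: such an edge
  would join the ends, so both paths would be that single edge.\<close>

lemma ends_edge_path_edges: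
  assumes "distinct (a # xs @ [b])" "{a, b} \<in> path_edges (a # xs @ [b])"
  shows "xs = []"
  using assms Union_path_edges_subset[of "xs @ [b]"] by (cases xs) (auto simp: doubleton_eq_iff)

text \<open>Boundaries are compared edge by edge, so a circuit is its edge set, without start or
  direction; \<open>circuitE\<close> recovers a vertex list starting at any chosen vertex.\<close>

definition circuit :: "'a set set \<Rightarrow> bool" where
  "circuit C \<longleftrightarrow> (\<exists>a xs. distinct (a # xs) \<and> 2 \<le> length xs \<and> C = path_edges (a # xs @ [a]))"

lemma circuitE:
  assumes "circuit C" "a \<in> \<Union>C"
  obtains xs where "distinct (a # xs)" "2 \<le> length xs" "C = path_edges (a # xs @ [a])"
proof -
  obtain b ys where b: "distinct (b # ys)" "2 \<le> length ys" "C = path_edges (b # ys @ [b])"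
    using assms(1) unfolding circuit_def by blast
  show ?thesis
  proof (cases "a = b")
    case True
    then show ?thesis using that b by blast
  next
    case False
    then have "a \<in> set ys" using assms(2) b(3) Union_path_edges_subset[of "b # ys @ [b]"] by auto
    then obtain l r where lr: "ys = l @ a # r" by (metis split_list)
    have "C = path_edges (a # (r @ b # l) @ [a])"
      using b(3) lr path_edges_append[of "b # l" a "r @ [b]"] path_edges_append[of "a # r" b "l @ [a]"]
      by auto
    then show ?thesis using that[of "r @ b # l"] b lr by auto
  qed
qed

text \<open>Either path may be the single edge \<open>ab\<close>, but not both, since a circuit has
  at least three vertices; this is the condition \<open>xs @ ys \<noteq> []\<close>.\<close>

lemma circuit_split:
  assumes "circuit C" "a \<in> \<Union>C" "b \<in> \<Union>C" "a \<noteq> b"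
  obtains xs ys where "distinct (a # b # xs @ ys)" "xs @ ys \<noteq> []"
    "C = path_edges (a # xs @ [b]) \<union> path_edges (a # ys @ [b])"
proof -
  obtain zs where z: "distinct (a # zs)" "2 \<le> length zs" "C = path_edges (a # zs @ [a])"
    using circuitE[OF assms(1,2)] .
  then have "b \<in> set zs" using assms(3,4) Union_path_edges_subset[of "a # zs @ [a]"] by auto
  then obtain l r where lr: "zs = l @ b # r" by (metis split_list)
  have "C = path_edges (a # l @ [b]) \<union> path_edges (a # rev r @ [b])"
    using z(3) lr path_edges_append[of "a # l" b "r @ [a]"] path_edges_rev[of "b # r @ [a]"] by simp
  moreover have "l @ rev r \<noteq> []" using z(2) lr by (cases l; cases r) auto
  ultimately show ?thesis using that[of l "rev r"] z lr by auto
qed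

lemma circuit_join:
  assumes "distinct (a # b # xs @ ys)" "xs @ ys \<noteq> []"
  shows "circuit (path_edges (a # xs @ [b]) \<union> path_edges (a # ys @ [b]))"
proof -
  have "path_edges (a # xs @ [b]) \<union> path_edges (a # ys @ [b])
    = path_edges (a # (xs @ b # rev ys) @ [a])"
    using path_edges_append[of "a # xs" b "rev ys @ [a]"] path_edges_rev[of "a # ys @ [b]"] by simp
  moreover have "2 \<le> length (xs @ b # rev ys)" using assms(2) by (cases xs; cases ys) auto
  moreover have "distinct (a # xs @ b # rev ys)" using assms(1) by auto
  ultimately show ?thesis unfolding circuit_def by blast
qed

lemma circuit_at:
  assumes "circuit C" "v \<in> \<Union>C"
  obtains u w where "u \<noteq> w" "v \<noteq> u" "v \<noteq> w" "{e \<in> C. v \<in> e} = {{v, u}, {v, w}}"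
proof -
  obtain xs where x: "distinct (v # xs)" "2 \<le> length xs" "C = path_edges (v # xs @ [v])"
    using circuitE[OF assms] .
  then obtain u w ys where xs: "xs = u # ys @ [w]"
    by (metis One_nat_def append_butlast_last_id length_0_conv length_Cons list.exhaust
        not_less_eq_eq numeral_2_eq_2 zero_le list.size(3))
  have "path_edges (v # xs @ [v]) = {{v, u}, {v, w}} \<union> path_edges xs"
    using path_edges_append[of "v # u # ys" w "[v]"] xs by (auto simp: insert_commute)
  then have "{e \<in> C. v \<in> e} = {{v, u}, {v, w}}"
    using x Union_path_edges_subset[of xs] by auto
  then show ?thesis using that[of u w] x xs by auto
qed

lemma circuit_card:
  assumes "circuit C"
  shows "card C = card (\<Union>C)" "3 \<le> card C" "finite C" "finite (\<Union>C)"
proof -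
  obtain a xs where x: "distinct (a # xs)" "2 \<le> length xs" "C = path_edges (a # xs @ [a])"
    using assms unfolding circuit_def by blast
  then obtain b ys where xs: "xs = ys @ [b]" by (cases xs rule: rev_cases) auto
  have 1: "C = insert {a, b} (path_edges (a # xs))"
    using x(3) xs path_edges_append[of "a # ys" b "[a]"] by (auto simp: insert_commute)
  have "{a, b} \<notin> path_edges (a # xs)"
    using ends_edge_path_edges[of a ys b] x xs by auto
  then have c: "card C = Suc (length xs)" using 1 card_path_edges[OF x(1)] by simp
  have U: "\<Union>C = set (a # xs)" using x(3) Union_path_edges[of "a # xs @ [a]"] by auto
  show "card C = card (\<Union>C)" using c U x(1) distinct_card[of "a # xs"] by simp
  show "3 \<le> card C" using c x by simp
  show "finite C" using 1 by simp
  show "finite (\<Union>C)" using U by simp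
qed

lemma circuit3:
  assumes "circuit C" "card C = 3" "a \<in> \<Union>C"
  obtains b c where "distinct [a, b, c]" "C = {{a, b}, {b, c}, {c, a}}"
proof -
  obtain xs where x: "distinct (a # xs)" "2 \<le> length xs" "C = path_edges (a # xs @ [a])"
    using circuitE[OF assms(1,3)] .
  have "\<Union>C = set (a # xs)" using x(3) Union_path_edges[of "a # xs @ [a]"] by auto
  then have "length xs = 2" using circuit_card(1)[OF assms(1)] assms(2) x(1) distinct_card[of "a # xs"] by simp
  then obtain b c where "xs = [b, c]" by (auto simp: length_Suc_conv numeral_2_eq_2)
  then show ?thesis using that x by auto
qed

lemma circuit4:
  assumes "circuit C" "card C = 4" "{a, b} \<in> C" "a \<noteq> b"
  obtains c d where "distinct [a, b, c, d]" "C = {{a, b}, {b, c}, {c, d}, {d, a}}"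
proof -
  obtain xs where x: "distinct (a # xs)" "2 \<le> length xs" "C = path_edges (a # xs @ [a])"
    using circuitE[OF assms(1), of a] assms(3) by blast
  have "\<Union>C = set (a # xs)" using x(3) Union_path_edges[of "a # xs @ [a]"] by auto
  then have "length xs = 3" using circuit_card(1)[OF assms(1)] assms(2) x(1) distinct_card[of "a # xs"] by simp
  then obtain p q r where xs: "xs = [p, q, r]" by (auto simp: length_Suc_conv numeral_3_eq_3)
  then have C: "C = {{a, p}, {p, q}, {q, r}, {r, a}}" "distinct [a, p, q, r]" using x by auto
  then have "b = p \<or> b = r" using assms(3,4) by (auto simp: doubleton_eq_iff)
  then show ?thesis
  proof
    assume "b = p" then show ?thesis using that[of q r] C by auto
  next
    assume "b = r" then show ?thesis using that[of q p] C by (auto simp: insert_commute)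
  qed
qed

text \<open>The last clause says that the rotation at each vertex is a single cycle.\<close>

definition facial_system :: "'a set set \<Rightarrow> 'f set \<Rightarrow> ('f \<Rightarrow> 'a set set) \<Rightarrow> bool" where
  "facial_system H F bd \<longleftrightarrow>
     finite H \<and> finite F \<and> (\<forall>R\<in>F. circuit (bd R) \<and> bd R \<subseteq> H) \<and>
     card F + card (\<Union>H) = card H + 2 \<and>
     (\<forall>e\<in>H. card {R \<in> F. e \<in> bd R} = 2) \<and>
     (\<forall>v S. S \<noteq> {} \<and> S \<subset> {e \<in> H. v \<in> e} \<longrightarrow>
        (\<exists>R\<in>F. \<exists>e\<in>S. \<exists>f\<in>{e \<in> H. v \<in> e} - S. e \<in> bd R \<and> f \<in> bd R))"

lemma facial_system_circuit:
  assumes C: "circuit C" and ne: "R1 \<noteq> R2"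
  shows "facial_system C {R1, R2} (\<lambda>_. C)"
proof -
  have "{R. R = R1 \<or> R = R2} = {R1, R2}" by auto
  then show ?thesis
    unfolding facial_system_def using circuit_card[OF C] C ne by auto
qed

text \<open>The face \<open>R\<close> is replaced by two faces, each bounded by the ear and one half
  of \<open>bd R\<close>. Faces grow by 1, vertices by \<open>length zs\<close> and edges by
  \<open>length zs + 1\<close>, so Euler's formula persists. Ear edges lie on both new faces, and
  each edge of \<open>bd R\<close> passes to exactly one of them. At an end of the ear, the new edge
  is inserted into the rotation between the two edges of \<open>bd R\<close>.\<close>

lemma facial_system_ear:
  fixes H :: "'a set set" and F :: "'f set"
  assumes fs: "facial_system H F bd" and R: "R \<in> F"
    and dR: "bd R = path_edges (a # xs @ [b]) \<union> path_edges (a # ys @ [b])"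
    and d: "distinct (a # b # xs @ ys)" "xs @ ys \<noteq> []"
    and dz: "distinct (a # b # zs)" "set zs \<inter> \<Union>H = {}" "path_edges (a # zs @ [b]) \<inter> H = {}"
    and new: "R1 \<notin> F" "R2 \<notin> F" "R1 \<noteq> R2"
  shows "facial_system (H \<union> path_edges (a # zs @ [b])) (insert R1 (insert R2 (F - {R})))
    (bd(R1 := path_edges (a # xs @ [b]) \<union> path_edges (a # zs @ [b]),
       R2 := path_edges (a # ys @ [b]) \<union> path_edges (a # zs @ [b])))"
proof -
  define E1 where "E1 = path_edges (a # xs @ [b])"
  define E2 where "E2 = path_edges (a # ys @ [b])"
  define P where "P = path_edges (a # zs @ [b])"
  define H' where "H' = H \<union> P"
  define F' where "F' = insert R1 (insert R2 (F - {R}))"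
  define bd' where "bd' = bd(R1 := E1 \<union> P, R2 := E2 \<union> P)"
  have fin: "finite H" "finite F" using fs by (auto simp: facial_system_def)
  have circ: "circuit (bd Q)" "bd Q \<subseteq> H" if "Q \<in> F" for Q
    using fs that by (auto simp: facial_system_def)
  have two: "card {Q \<in> F. e \<in> bd Q} = 2" if "e \<in> H" for e using fs that by (auto simp: facial_system_def)
  have cut: "\<exists>Q\<in>F. \<exists>e\<in>S. \<exists>f\<in>{e \<in> H. v \<in> e} - S. e \<in> bd Q \<and> f \<in> bd Q"
    if "S \<noteq> {}" "S \<subset> {e \<in> H. v \<in> e}" for v S
    using fs that unfolding facial_system_def by blast
  have R12: "E1 \<subseteq> H" "E2 \<subseteq> H" using circ(2)[OF R] dR by (auto simp: E1_def E2_def)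
  have UE: "\<Union>E1 = set (a # xs @ [b])" "\<Union>E2 = set (a # ys @ [b])" "\<Union>P = set (a # zs @ [b])"
    by (simp_all add: E1_def E2_def P_def Union_path_edges)
  have abH: "a \<in> \<Union>H" "b \<in> \<Union>H" using UE(1) Union_mono[OF R12(1)] by auto
  have E12: "E1 \<inter> E2 = {}"
  proof (rule ccontr)
    assume "E1 \<inter> E2 \<noteq> {}"
    then obtain e where e: "e \<in> E1" "e \<in> E2" by auto
    then have "e \<subseteq> \<Union>E1 \<inter> \<Union>E2" by auto
    then have "e \<subseteq> {a, b}" using UE d by auto
    moreover have "card e = 2" using e(1) card2_path_edges[of "a # xs @ [b]"] d by (auto simp: E1_def)
    ultimately have "e = {a, b}" using d by (metis card_2_iff card_subset_eq distinct_length_2_or_more finite.emptyI finite_insert)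
    then have "xs = []" "ys = []"
      using ends_edge_path_edges[of a xs b] ends_edge_path_edges[of a ys b] e d
      by (auto simp: E1_def E2_def)
    then show False using d by simp
  qed
  have PH: "P \<inter> H = {}" using dz by (simp add: P_def)
  \<comment> \<open>If \<open>zs\<close> and one of \<open>xs\<close>, \<open>ys\<close> were both
    empty, the edge \<open>ab\<close> would belong to \<open>P\<close> and to
    \<open>H\<close>.\<close>
  have ne: "xs @ zs \<noteq> []" "ys @ zs \<noteq> []"
    using PH R12 by (auto simp: P_def E1_def E2_def)
  have dist: "distinct (a # b # xs @ zs)" "distinct (a # b # ys @ zs)"
  proof -
    have "set xs \<subseteq> \<Union>H" "set ys \<subseteq> \<Union>H"
      using UE(1,2) Union_mono[OF R12(1)] Union_mono[OF R12(2)] by simp_all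
    then have "set xs \<inter> set zs = {}" "set ys \<inter> set zs = {}" using dz(2) by blast+
    then show "distinct (a # b # xs @ zs)" "distinct (a # b # ys @ zs)" using d(1) dz(1) by simp_all
  qed
  have circ': "circuit (bd' Q) \<and> bd' Q \<subseteq> H'" if Q: "Q \<in> F'" for Q
  proof -
    consider "Q = R1" | "Q = R2" "Q \<noteq> R1" | "Q \<noteq> R1" "Q \<noteq> R2" "Q \<in> F"
      using Q by (auto simp: F'_def)
    then show ?thesis
    proof cases
      case 1
      then have "bd' Q = E1 \<union> P" using new by (simp add: bd'_def)
      then show ?thesis
        using circuit_join[OF dist(1) ne(1)] R12 by (auto simp: E1_def P_def H'_def)
    next
      case 2
      then have "bd' Q = E2 \<union> P" by (simp add: bd'_def)
      then show ?thesis
        using circuit_join[OF dist(2) ne(2)] R12 by (auto simp: E2_def P_def H'_def)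
    next
      case 3
      then have "bd' Q = bd Q" by (simp add: bd'_def)
      then show ?thesis using circ[OF 3(3)] by (auto simp: H'_def)
    qed
  qed
  have cF: "card F' = card F + 1"
    using new fin R by (simp add: F'_def card_Diff_singleton) (metis Suc_pred card_gt_0_iff empty_iff)
  have cP: "card P = length zs + 1" using card_path_edges[of a "zs @ [b]"] dz by (auto simp: P_def)
  have cH: "card H' = card H + card P"
    using PH fin by (simp add: H'_def card_Un_disjoint Int_commute P_def)
  \<comment> \<open>A facial system says nothing direct about the size of an edge, but every edge
    lies on a circuit, which has finitely many vertices.\<close>
  have finU: "finite (\<Union>H)"
  proof (rule finite_Union[OF fin(1)])
    fix e assume "e \<in> H"
    then have "{Q \<in> F. e \<in> bd Q} \<noteq> {}" using two[of e] by force
    then obtain Q where "Q \<in> F" "e \<in> bd Q" by blast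
    then show "finite e"
      using circuit_card(4)[OF circ(1)[of Q]] by (meson Union_upper finite_subset)
  qed
  have "\<Union>H' = \<Union>H \<union> set zs" using UE abH by (auto simp: H'_def)
  then have cU: "card (\<Union>H') = card (\<Union>H) + length zs"
    using dz finU distinct_card[of zs] by (simp add: card_Un_disjoint Int_commute)
  have count: "card F' + card (\<Union>H') = card H' + 2"
    using fs cF cP cH cU by (simp add: facial_system_def)
  have two': "card {Q \<in> F'. e \<in> bd' Q} = 2" if e: "e \<in> H'" for e
  proof (cases "e \<in> P")
    case True
    then have "{Q \<in> F'. e \<in> bd' Q} = {R1, R2}"
      using new PH circ(2) by (auto simp: F'_def bd'_def)
    then show ?thesis using new by simp
  next
    case False
    then have eH: "e \<in> H" using e by (auto simp: H'_def)
    show ?thesis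
    proof (cases "e \<in> bd R")
      case True
      let ?Q = "if e \<in> E1 then R1 else R2"
      have "{Q \<in> F'. e \<in> bd' Q} = insert ?Q ({Q \<in> F. e \<in> bd Q} - {R})"
        using True False E12 new dR by (auto simp: F'_def bd'_def E1_def E2_def)
      moreover have "?Q \<notin> {Q \<in> F. e \<in> bd Q} - {R}" using new by auto
      ultimately show ?thesis using two[OF eH] fin R True by (simp add: card_Diff_singleton)
    next
      case F: False
      then have "{Q \<in> F'. e \<in> bd' Q} = {Q \<in> F. e \<in> bd Q}"
        using False new dR by (auto simp: F'_def bd'_def E1_def E2_def)
      then show ?thesis using two[OF eH] by simp
    qed
  qed
  have cut': "\<exists>Q\<in>F'. \<exists>e\<in>S. \<exists>f\<in>{e \<in> H'. v \<in> e} - S. e \<in> bd' Q \<and> f \<in> bd' Q"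
    if S: "S \<noteq> {}" "S \<subset> {e \<in> H'. v \<in> e}" for v S
  proof -
    have d1: "bd' R1 = E1 \<union> P" "R1 \<in> F'" "bd' R2 = E2 \<union> P" "R2 \<in> F'"
      using new by (auto simp: bd'_def F'_def)
    obtain f0 where f0: "f0 \<in> H'" "v \<in> f0" "f0 \<notin> S" using S(2) by auto
    obtain s0 where s0: "s0 \<in> S" "s0 \<in> H'" "v \<in> s0" using S by auto
    \<comment> \<open>A witness face of the old system remains one, except that for \<open>R\<close>
      itself both edges must lie on the same half of its boundary.\<close>
    have old: ?thesis if h: "Q \<in> F" "e \<in> S" "f \<in> H" "v \<in> f" "f \<notin> S" "e \<in> bd Q" "f \<in> bd Q"
      "Q = R \<Longrightarrow> e \<in> E1 \<and> f \<in> E1 \<or> e \<in> E2 \<and> f \<in> E2" for Q e f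
    proof (cases "Q = R")
      case True
      then show ?thesis using h d1 by (auto simp: H'_def)
    next
      case False
      then have "Q \<in> F'" "bd' Q = bd Q" using h(1) new by (auto simp: F'_def bd'_def)
      then show ?thesis using h by (auto simp: H'_def)
    qed
    have wit: ?thesis
      if "Q \<in> F'" "e \<in> S" "f \<in> H'" "v \<in> f" "f \<notin> S" "e \<in> bd' Q" "f \<in> bd' Q" for Q e f
      using that by blast
    consider "v = a \<or> v = b" | "v \<noteq> a" "v \<noteq> b" "v \<in> set zs" | "v \<noteq> a" "v \<noteq> b" "v \<notin> set zs" by blast
    then show ?thesis
    proof cases
      case 1
      \<comment> \<open>At an end of the ear, \<open>p\<close> is the ear edge and
        \<open>q1\<close>, \<open>q2\<close> are the edges of the two halves of \<open>bd R\<close>.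
        The face \<open>R1\<close> links \<open>p\<close> with \<open>q1\<close>, and
        \<open>R2\<close> links \<open>p\<close> with \<open>q2\<close>; if \<open>S\<close>
        separates one of these pairs, that face is the witness.\<close>
      obtain p q1 q2 where p: "{e \<in> P. v \<in> e} = {p}" and q: "{e \<in> E1. v \<in> e} = {q1}" "{e \<in> E2. v \<in> e} = {q2}"
      proof (cases "v = a")
        case True
        then show ?thesis
          using that path_edges_at_start[of a "zs @ [b]"] path_edges_at_start[of a "xs @ [b]"]
            path_edges_at_start[of a "ys @ [b]"] d dz by (auto simp: P_def E1_def E2_def)
      next
        case False
        then have "v = b" using 1 by simp
        then show ?thesis
          using that path_edges_at_end[of "a # zs" b] path_edges_at_end[of "a # xs" b]
            path_edges_at_end[of "a # ys" b] d dz by (auto simp: P_def E1_def E2_def)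
      qed
      have pp: "p \<in> P" "v \<in> p" "q1 \<in> E1" "v \<in> q1" "q2 \<in> E2" "v \<in> q2" using p q by auto
      have H'v: "{e \<in> H'. v \<in> e} = insert p {e \<in> H. v \<in> e}" using p by (auto simp: H'_def)
      have mem: "p \<in> H'" "q1 \<in> H'" "q2 \<in> H'" "p \<in> bd' R1" "q1 \<in> bd' R1" "p \<in> bd' R2" "q2 \<in> bd' R2"
        using pp R12 d1 by (auto simp: H'_def)
      show ?thesis
      proof (cases "p \<in> S \<longleftrightarrow> q1 \<in> S")
        case False
        then show ?thesis
          using wit[of R1 p q1] wit[of R1 q1 p] mem pp d1 by (cases "p \<in> S") simp_all
      next
        case pq1: True
        show ?thesis
        proof (cases "p \<in> S \<longleftrightarrow> q2 \<in> S")
          case False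
          then show ?thesis
            using wit[of R2 p q2] wit[of R2 q2 p] mem pp d1 by (cases "p \<in> S") simp_all
        next
          case pq2: True
          \<comment> \<open>Now \<open>S\<close> contains all or none of \<open>p\<close>,
            \<open>q1\<close>, \<open>q2\<close>, so removing \<open>p\<close> gives a proper
            nonempty set of old edges. The old witness cannot be \<open>R\<close>, whose only edges
            at \<open>v\<close> are \<open>q1\<close> and \<open>q2\<close>.\<close>
          have q1: "q1 \<in> H" "v \<in> q1" "p \<notin> H" using pp R12 PH by blast+
          then have "q1 \<noteq> p" by auto
          then have "S - {p} \<noteq> {}" using s0(1) pq1 by blast
          moreover have "S - {p} \<subset> {e \<in> H. v \<in> e}"
          proof
            show "S - {p} \<subseteq> {e \<in> H. v \<in> e}" using S(2) H'v by blast
            show "S - {p} \<noteq> {e \<in> H. v \<in> e}"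
            proof
              assume eq: "S - {p} = {e \<in> H. v \<in> e}"
              then have "q1 \<in> S" using q1 by blast
              then have "p \<in> S" using pq1 by simp
              moreover have "f0 \<in> insert p {e \<in> H. v \<in> e}" using f0 H'v by blast
              ultimately show False using eq f0(3) by blast
            qed
          qed
          ultimately have "\<exists>Q\<in>F. \<exists>e\<in>S - {p}. \<exists>f\<in>{e \<in> H. v \<in> e} - (S - {p}). e \<in> bd Q \<and> f \<in> bd Q"
            by (rule cut)
          then obtain Q e f where Q: "Q \<in> F" "e \<in> S - {p}" "f \<in> {e \<in> H. v \<in> e} - (S - {p})"
            "e \<in> bd Q" "f \<in> bd Q" by blast
          have fS: "f \<notin> S" using Q(3) q1(3) by blast
          show ?thesis
          proof (rule old[of Q e f])
            assume "Q = R"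
            moreover have "v \<in> e" "v \<in> f" using Q(2,3) S(2) by blast+
            ultimately have "e \<in> {q1, q2}" "f \<in> {q1, q2}"
              using Q(4,5) dR q unfolding E1_def[symmetric] E2_def[symmetric] by blast+
            then show "e \<in> E1 \<and> f \<in> E1 \<or> e \<in> E2 \<and> f \<in> E2" using pq1 pq2 Q(2) fS by auto
          qed (use Q fS in blast)+
        qed
      qed
    next
      case 2
      \<comment> \<open>An inner vertex of the ear meets only ear edges, and all of these lie on
        \<open>R1\<close>.\<close>
      then have "{e \<in> H'. v \<in> e} \<subseteq> P" using dz by (auto simp: H'_def)
      then show ?thesis using d1 s0 f0 by blast
    next
      case 3
      then have Hv: "{e \<in> H'. v \<in> e} = {e \<in> H. v \<in> e}" using UE(3) by (auto simp: H'_def)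
      have "\<exists>Q\<in>F. \<exists>e\<in>S. \<exists>f\<in>{e \<in> H. v \<in> e} - S. e \<in> bd Q \<and> f \<in> bd Q"
        by (rule cut[OF S(1)]) (use S(2) Hv in simp)
      then obtain Q e f where Q: "Q \<in> F" "e \<in> S" "f \<in> {e \<in> H. v \<in> e} - S"
            "e \<in> bd Q" "f \<in> bd Q" by blast
      show ?thesis
      proof (rule old[of Q e f])
        assume "Q = R"
        then have "e \<in> E1 \<union> E2" "f \<in> E1 \<union> E2" using Q dR by (auto simp: E1_def E2_def)
        moreover have "v \<in> e" "v \<in> f" using Q S by auto
        moreover have "v \<notin> \<Union>E1 \<inter> \<Union>E2" using UE d 3 by auto
        ultimately show "e \<in> E1 \<and> f \<in> E1 \<or> e \<in> E2 \<and> f \<in> E2" by blast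
      qed (use Q in blast)+
    qed
  qed
  show ?thesis
    unfolding facial_system_def E1_def[symmetric] E2_def[symmetric] P_def[symmetric]
      H'_def[symmetric] F'_def[symmetric] bd'_def[symmetric]
    using fin circ' count two' cut' by (auto simp: H'_def F'_def P_def)
qed

section \<open>Faces of plane graphs\<close>

locale plane_drawn =
  fixes G :: "'a graph" and p :: "'a \<Rightarrow> complex" and \<gamma> :: "'a set \<Rightarrow> real \<Rightarrow> complex"
  assumes simple: "finite_simple_graph G" and drawing: "plane_drawing G p \<gamma>"
begin

definition drawn :: "'a set set \<Rightarrow> complex set" where
  "drawn H = (\<Union>e\<in>H. path_image (\<gamma> e))"

lemma edge_verts: "e \<in> edges G \<Longrightarrow> e \<subseteq> verts G"
  using simple by (auto simp: finite_simple_graph_def)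

lemma inj_p: "inj_on p (verts G)"
  using drawing by (auto simp: plane_drawing_def)

lemma drawn_Un: "drawn (A \<union> B) = drawn A \<union> drawn B"
  by (auto simp: drawn_def)

lemma arc_edge:
  assumes "{x, y} \<in> edges G" "x \<noteq> y"
  shows "arc_between (p x) (p y) (path_image (\<gamma> {x, y}))"
proof -
  have a: "arc (\<gamma> {x, y})" "{pathstart (\<gamma> {x, y}), pathfinish (\<gamma> {x, y})} = {p x, p y}"
    using assms drawing by (auto simp: plane_drawing_def)
  then have "arc_between (pathstart (\<gamma> {x, y})) (pathfinish (\<gamma> {x, y})) (path_image (\<gamma> {x, y}))"
    unfolding arc_between_def by blast
  then show ?thesis using a(2) arc_between_sym by (auto simp: doubleton_eq_iff)
qed

lemma drawn_Int:
  assumes "A \<subseteq> edges G" "B \<subseteq> edges G" "A \<inter> B = {}"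
  shows "drawn A \<inter> drawn B \<subseteq> p ` (\<Union>A \<inter> \<Union>B)"
proof
  fix x assume "x \<in> drawn A \<inter> drawn B"
  then obtain e f where ef: "e \<in> A" "f \<in> B" "x \<in> path_image (\<gamma> e)" "x \<in> path_image (\<gamma> f)"
    by (auto simp: drawn_def)
  then have "e \<noteq> f" "e \<in> edges G" "f \<in> edges G" using assms by auto
  then have "path_image (\<gamma> e) \<inter> path_image (\<gamma> f) \<subseteq> p ` (e \<inter> f)"
    using drawing by (auto simp: plane_drawing_def)
  then show "x \<in> p ` (\<Union>A \<inter> \<Union>B)" using ef by blast
qed

lemma drawn_vertex:
  assumes "A \<subseteq> edges G" "v \<in> verts G"
  shows "p v \<in> drawn A \<longleftrightarrow> v \<in> \<Union>A"
proof
  assume "p v \<in> drawn A"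
  then obtain e where e: "e \<in> A" "p v \<in> path_image (\<gamma> e)" by (auto simp: drawn_def)
  then have "path_image (\<gamma> e) \<inter> p ` verts G \<subseteq> p ` e"
    using drawing assms(1) e(1) unfolding plane_drawing_def by blast
  then have "p v \<in> p ` e" using e assms(2) by blast
  then show "v \<in> \<Union>A" using e inj_p edge_verts[of e] assms by (auto simp: inj_on_def)
next
  assume "v \<in> \<Union>A"
  then obtain e where e: "e \<in> A" "v \<in> e" by auto
  then have "{pathstart (\<gamma> e), pathfinish (\<gamma> e)} = p ` e"
    using drawing assms by (auto simp: plane_drawing_def)
  then have "p v \<in> {pathstart (\<gamma> e), pathfinish (\<gamma> e)}" using e by blast
  then have "p v \<in> path_image (\<gamma> e)" by auto
  then show "p v \<in> drawn A" using e by (auto simp: drawn_def)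
qed

lemma arc_between_path:
  assumes "distinct (x # xs)" "xs \<noteq> []" "path_edges (x # xs) \<subseteq> edges G"
  shows "arc_between (p x) (p (last xs)) (drawn (path_edges (x # xs)))"
  using assms
proof (induction xs arbitrary: x)
  case (Cons y xs)
  have e: "arc_between (p x) (p y) (path_image (\<gamma> {x, y}))"
    using Cons.prems by (intro arc_edge) auto
  show ?case
  proof (cases "xs = []")
    case True
    then show ?thesis using e by (simp add: drawn_def)
  next
    case False
    have 1: "drawn (path_edges (x # y # xs)) = drawn {{x, y}} \<union> drawn (path_edges (y # xs))"
      by (simp add: drawn_def)
    have "{x, y} \<notin> path_edges (y # xs)"
      using Cons.prems(1) Union_path_edges_subset[of "y # xs"] by auto
    then have "drawn {{x, y}} \<inter> drawn (path_edges (y # xs)) \<subseteq> p ` ({x, y} \<inter> \<Union>(path_edges (y # xs)))"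
      using drawn_Int[of "{{x, y}}" "path_edges (y # xs)"] Cons.prems(3) by auto
    also have "\<dots> \<subseteq> {p y}" using Cons.prems(1) Union_path_edges_subset[of "y # xs"] by auto
    finally have "drawn {{x, y}} \<inter> drawn (path_edges (y # xs)) \<subseteq> {p y}" .
    moreover have "arc_between (p y) (p (last xs)) (drawn (path_edges (y # xs)))"
      using Cons False by auto
    moreover have "drawn {{x, y}} = path_image (\<gamma> {x, y})" by (simp add: drawn_def)
    ultimately show ?thesis
      using arc_between_join[of "p x" "p y" "drawn {{x, y}}"] e False
      unfolding 1 by simp
  qed
qed simp

text \<open>The invariant of the ear construction. The frontier clause ties the combinatorial
  boundary to the drawing; it is needed to find the ends of the next ear on the boundary of its
  face.\<close>

definition plane_faces :: "'a set set \<Rightarrow> complex set set \<Rightarrow> (complex set \<Rightarrow> 'a set set) \<Rightarrow> bool" where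
  "plane_faces H F bd \<longleftrightarrow> H \<subseteq> edges G \<and> facial_system H F bd \<and> F = components (- drawn H) \<and>
     (\<forall>R\<in>F. frontier R = drawn (bd R))"

lemma two_paths_Int:
  assumes "distinct (a # b # xs @ ys)" "xs @ ys \<noteq> []"
    "path_edges (a # xs @ [b]) \<subseteq> edges G" "path_edges (a # ys @ [b]) \<subseteq> edges G"
  shows "drawn (path_edges (a # xs @ [b])) \<inter> drawn (path_edges (a # ys @ [b])) = {p a, p b}"
proof
  have i: "\<Union>(path_edges (a # xs @ [b])) \<inter> \<Union>(path_edges (a # ys @ [b])) = {a, b}"
    using assms(1) Union_path_edges[of "a # xs @ [b]"] Union_path_edges[of "a # ys @ [b]"] by auto
  have "path_edges (a # xs @ [b]) \<inter> path_edges (a # ys @ [b]) = {}"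
  proof (rule ccontr)
    assume "path_edges (a # xs @ [b]) \<inter> path_edges (a # ys @ [b]) \<noteq> {}"
    then obtain e where e: "e \<in> path_edges (a # xs @ [b])" "e \<in> path_edges (a # ys @ [b])" by auto
    then have "e \<subseteq> {a, b}" using i by blast
    moreover have "card e = 2" using e(1) card2_path_edges[of "a # xs @ [b]"] assms(1) by auto
    ultimately have "e = {a, b}"
      using assms(1) by (metis card_2_iff card_subset_eq distinct_length_2_or_more finite.emptyI finite_insert)
    then show False
      using ends_edge_path_edges[of a xs b] ends_edge_path_edges[of a ys b] e assms by auto
  qed
  then show "drawn (path_edges (a # xs @ [b])) \<inter> drawn (path_edges (a # ys @ [b])) \<subseteq> {p a, p b}"
    using drawn_Int[OF assms(3,4)] i by auto
  show "{p a, p b} \<subseteq> drawn (path_edges (a # xs @ [b])) \<inter> drawn (path_edges (a # ys @ [b]))"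
    using arc_between_ends[OF arc_between_path[of a "xs @ [b]"]]
      arc_between_ends[OF arc_between_path[of a "ys @ [b]"]] assms by auto
qed

lemma plane_faces_circuit:
  assumes "circuit C" "C \<subseteq> edges G"
  shows "\<exists>F bd. plane_faces C F bd"
proof -
  obtain a xs where x: "distinct (a # xs)" "2 \<le> length xs" "C = path_edges (a # xs @ [a])"
    using assms(1) unfolding circuit_def by blast
  have "\<Union>C = set (a # xs)" using x(3) Union_path_edges[of "a # xs @ [a]"] by auto
  then obtain b where b: "a \<in> \<Union>C" "b \<in> \<Union>C" "a \<noteq> b" using x by (cases xs) auto
  obtain ys zs where yz: "distinct (a # b # ys @ zs)" "ys @ zs \<noteq> []"
    "C = path_edges (a # ys @ [b]) \<union> path_edges (a # zs @ [b])"
    using circuit_split[OF assms(1) b] .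
  let ?A = "drawn (path_edges (a # ys @ [b]))" and ?B = "drawn (path_edges (a # zs @ [b]))"
  have A: "arc_between (p a) (p b) ?A" using arc_between_path[of a "ys @ [b]"] yz assms(2) by auto
  have B: "arc_between (p a) (p b) ?B" using arc_between_path[of a "zs @ [b]"] yz assms(2) by auto
  have AB: "?A \<inter> ?B = {p a, p b}" by (rule two_paths_Int) (use yz assms(2) in auto)
  have C: "drawn C = ?A \<union> ?B" by (simp add: yz(3) drawn_Un)
  note j = arc_between_jordan[OF A B AB, folded C]
  have "inside (drawn C) \<noteq> outside (drawn C)" using j(1,9) by blast
  then have "facial_system C {inside (drawn C), outside (drawn C)} (\<lambda>_. C)"
    by (rule facial_system_circuit[OF assms(1)])
  moreover have "components (- drawn C) = {inside (drawn C), outside (drawn C)}"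
    using components_jordan[OF A B AB] C by simp
  ultimately have "plane_faces C {inside (drawn C), outside (drawn C)} (\<lambda>_. C)"
    using j(11,12) assms(2) by (simp add: plane_faces_def)
  then show ?thesis by blast
qed

text \<open>The interior of the ear is connected and misses the drawing of \<open>H\<close>, so it
  lies in one face \<open>R\<close>. Its ends lie on the circuit \<open>bd R\<close> and split it
  into two paths, which form a theta graph with the ear. All other faces are untouched.\<close>

lemma plane_faces_ear:
  assumes pf: "plane_faces H F bd" and z: "distinct (a # b # zs)" "set zs \<inter> \<Union>H = {}"
    "path_edges (a # zs @ [b]) \<inter> H = {}" "path_edges (a # zs @ [b]) \<subseteq> edges G"
    and ab: "a \<in> \<Union>H" "b \<in> \<Union>H"
  shows "\<exists>F' bd'. plane_faces (H \<union> path_edges (a # zs @ [b])) F' bd'"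
proof -
  let ?P = "path_edges (a # zs @ [b])"
  let ?C = "drawn ?P"
  have HE: "H \<subseteq> edges G" and fs: "facial_system H F bd" and F: "F = components (- drawn H)"
    and fr: "\<And>R. R \<in> F \<Longrightarrow> frontier R = drawn (bd R)"
    using pf by (auto simp: plane_faces_def)
  have av: "a \<in> verts G" "b \<in> verts G" using ab HE edge_verts by blast+
  have C: "arc_between (p a) (p b) ?C" using arc_between_path[of a "zs @ [b]"] z by auto
  have "\<Union>?P \<inter> \<Union>H = {a, b}" using z(2) ab Union_path_edges[of "a # zs @ [b]"] by auto
  then have CH: "?C \<inter> drawn H \<subseteq> {p a, p b}" using drawn_Int[OF z(4) HE z(3)] by auto
  have "closed (drawn H)"
  proof -
    have "finite H" using fs by (simp add: facial_system_def)
    moreover have "closed (path_image (\<gamma> e))" if "e \<in> H" for e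
      using that HE drawing by (auto simp: plane_drawing_def intro!: closed_path_image arc_imp_path)
    ultimately show ?thesis by (auto simp: drawn_def)
  qed
  then have op: "open (- drawn H)" by auto
  have "?C - {p a, p b} \<subseteq> - drawn H" using CH by blast
  then obtain R where R: "R \<in> F" "?C - {p a, p b} \<subseteq> R"
    using exists_component_superset[of "?C - {p a, p b}" "- drawn H"] arc_between_interior[OF C] F
    by blast
  have Rsub: "R \<subseteq> - drawn H" using R F in_components_subset by blast
  have opR: "open R" using R F op open_components by blast
  have dRE: "bd R \<subseteq> edges G" and circ: "circuit (bd R)" using fs R HE by (auto simp: facial_system_def)
  \<comment> \<open>An end of the ear is a limit of ear points in \<open>R\<close> but lies on the
    drawing of \<open>H\<close>, hence it is on the frontier of \<open>R\<close>.\<close>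
  have inR: "v \<in> \<Union>(bd R)" if v: "v \<in> {a, b}" for v
  proof -
    have "p v \<in> closure R"
      using arc_between_interior(4)[OF C] closure_mono[OF R(2)] arc_between_ends[OF C] v by auto
    moreover have "p v \<in> drawn H" using drawn_vertex[OF HE, of v] av ab v by auto
    ultimately have "p v \<in> frontier R" using Rsub opR by (auto simp: frontier_def interior_open)
    then show ?thesis using fr[OF R(1)] drawn_vertex[OF dRE, of v] av v by auto
  qed
  have "a \<noteq> b" using z by simp
  then obtain xs ys where xy: "distinct (a # b # xs @ ys)" "xs @ ys \<noteq> []"
    "bd R = path_edges (a # xs @ [b]) \<union> path_edges (a # ys @ [b])"
    using circuit_split[OF circ inR inR] by blast
  let ?A = "drawn (path_edges (a # xs @ [b]))" and ?B = "drawn (path_edges (a # ys @ [b]))"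
  have A: "arc_between (p a) (p b) ?A" using arc_between_path[of a "xs @ [b]"] xy dRE by auto
  have B: "arc_between (p a) (p b) ?B" using arc_between_path[of a "ys @ [b]"] xy dRE by auto
  have AB: "?A \<inter> ?B = {p a, p b}" by (rule two_paths_Int) (use xy dRE in auto)
  have dRH: "bd R \<subseteq> H" using fs R by (auto simp: facial_system_def)
  then have ABH: "?A \<subseteq> drawn H" "?B \<subseteq> drawn H" using xy(3) by (auto simp: drawn_def)
  have AC: "?A \<inter> ?C = {p a, p b}" "?B \<inter> ?C = {p a, p b}"
    using ABH CH arc_between_ends[OF A] arc_between_ends[OF B] arc_between_ends[OF C] by blast+
  have fR: "frontier R = ?A \<union> ?B" using fr[OF R(1)] xy(3) by (simp add: drawn_Un)
  \<comment> \<open>Deleting the rest of \<open>H\<close> from the drawing does not enlarge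
    \<open>R\<close>: a larger connected set would have to cross its frontier, which is the curve
    itself. So the theta lemma applies to the curve alone.\<close>
  have Rcomp: "R \<in> components (- (?A \<union> ?B))"
  proof -
    have con: "connected R" "R \<noteq> {}" using R F in_components_connected in_components_nonempty by blast+
    have "R \<subseteq> - (?A \<union> ?B)" using Rsub ABH by blast
    moreover have "T = R" if T: "R \<subseteq> T" "T \<subseteq> - (?A \<union> ?B)" "connected T" for T
    proof (rule ccontr)
      assume "T \<noteq> R"
      then have "T \<inter> frontier R \<noteq> {}"
        using connected_Int_frontier[OF T(3), of R] T(1) con by blast
      then show False using fR T(2) by blast
    qed
    ultimately show ?thesis using con by (auto simp: in_components_maximal)
  qed
  obtain R1 R2 where R12: "R1 \<inter> R2 = {}" "R1 \<union> R2 = R - ?C" "open R1" "open R2" "connected R1" "connected R2"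
    "R1 \<noteq> {}" "R2 \<noteq> {}" "frontier R1 = ?A \<union> ?C" "frontier R2 = ?B \<union> ?C"
    using theta_split[OF A B C AB AC Rcomp R(2)] by blast
  have disj: "X = Y" if "X \<in> F" "Y \<in> F" "X \<inter> Y \<noteq> {}" for X Y
    using that F components_nonoverlap by blast
  have new: "R1 \<notin> F" "R2 \<notin> F" "R1 \<noteq> R2"
    using disj[of R1 R] disj[of R2 R] R(1) R12 by blast+
  let ?F' = "insert R1 (insert R2 (F - {R}))"
  let ?bd' = "bd(R1 := path_edges (a # xs @ [b]) \<union> ?P, R2 := path_edges (a # ys @ [b]) \<union> ?P)"
  have "components (- drawn (H \<union> ?P)) = ?F'"
  proof (rule components_unique)
    show "pairwise disjnt ?F'"
    proof -
      have "X \<inter> R = {}" if "X \<in> F - {R}" for X using disj[of X R] that R by blast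
      then have h: "X \<inter> R1 = {}" "X \<inter> R2 = {}" if "X \<in> F - {R}" for X using that R12(2) by blast+
      have "X \<inter> Y = {}" if "X \<in> ?F'" "Y \<in> ?F'" "X \<noteq> Y" for X Y
        using that R12(1) disj[of X Y] h[of X] h[of Y] by blast
      then show ?thesis by (simp add: pairwise_def disjnt_def)
    qed
    have "open X \<and> connected X \<and> X \<noteq> {}" if "X \<in> F" for X
      using that F op open_components in_components_connected in_components_nonempty by blast
    then show "open X \<and> connected X \<and> X \<noteq> {}" if "X \<in> ?F'" for X
      using that R12 by blast
    have UF: "\<Union>F = - drawn H" using F by simp
    have "\<Union>(F - {R}) = (- drawn H) - R" using UF disj R(1) by blast
    moreover have "?C \<subseteq> R \<union> drawn H" using R(2) arc_between_ends[OF A] ABH by blast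
    ultimately show "\<Union>?F' = - drawn (H \<union> ?P)" using R12(2) Rsub by (auto simp: drawn_Un)
  qed
  moreover have "facial_system (H \<union> ?P) ?F' ?bd'"
    by (rule facial_system_ear[OF fs R(1) xy(3,1,2) z(1-3) new])
  moreover have "frontier X = drawn (?bd' X)" if "X \<in> ?F'" for X
    using that fr R12(9,10) new by (auto simp: drawn_Un)
  ultimately have "plane_faces (H \<union> ?P) ?F' ?bd'" using HE z(4) by (auto simp: plane_faces_def)
  then show ?thesis by blast
qed

end

section \<open>Ears of end blocks\<close>

text \<open>With \<open>u\<close> in \<open>A\<close> this is the component of \<open>u\<close> in
  the graph induced on \<open>A\<close>. By reflexivity \<open>u\<close> is included even if it is
  outside \<open>A\<close>, hence the membership assumptions later.\<close>

definition reach :: "'a set set \<Rightarrow> 'a set \<Rightarrow> 'a \<Rightarrow> 'a set" where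
  "reach E A u = {w. (u, w) \<in> {(x, y). {x, y} \<in> E \<and> x \<in> A \<and> y \<in> A}\<^sup>*}"

lemma reach_refl: "u \<in> reach E A u"
  by (simp add: reach_def)

lemma reach_step: "z \<in> reach E A u \<Longrightarrow> {z, z'} \<in> E \<Longrightarrow> z \<in> A \<Longrightarrow> z' \<in> A \<Longrightarrow> z' \<in> reach E A u"
  unfolding reach_def by (auto intro: rtrancl_into_rtrancl)

lemma reach_induct [consumes 1, case_names refl step]:
  assumes "w \<in> reach E A u" "P u"
    "\<And>z z'. P z \<Longrightarrow> {z, z'} \<in> E \<Longrightarrow> z \<in> A \<Longrightarrow> z' \<in> A \<Longrightarrow> P z'"
  shows "P w"
  using assms(1) unfolding reach_def mem_Collect_eq
  by (induction rule: rtrancl_induct) (use assms(2,3) in auto)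

lemma reach_subset: "u \<in> A \<Longrightarrow> reach E A u \<subseteq> A"
proof
  fix w assume "u \<in> A" "w \<in> reach E A u"
  from this(2,1) show "w \<in> A" by (induction rule: reach_induct)
qed

lemma reach_sym: "w \<in> reach E A u \<Longrightarrow> u \<in> reach E A w"
proof -
  have "sym ({(x, y). {x, y} \<in> E \<and> x \<in> A \<and> y \<in> A}\<^sup>*)"
    by (rule sym_rtrancl) (auto simp: sym_def insert_commute)
  then show "w \<in> reach E A u \<Longrightarrow> u \<in> reach E A w" by (auto simp: reach_def sym_def)
qed

lemma reach_trans: "v \<in> reach E A u \<Longrightarrow> w \<in> reach E A v \<Longrightarrow> w \<in> reach E A u"
  by (auto simp: reach_def)

lemma reach_path:
  assumes "w \<in> reach E A u" "w \<in> A"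
  shows "\<exists>xs. distinct (u # xs) \<and> last (u # xs) = w \<and> set (u # xs) \<subseteq> A \<and> path_edges (u # xs) \<subseteq> E"
  using assms(1) unfolding reach_def mem_Collect_eq
proof (induction rule: converse_rtrancl_induct)
  case base
  show ?case using assms(2) by (intro exI[of _ "[]"]) auto
next
  case (step x y)
  then obtain xs where xs: "distinct (y # xs)" "last (y # xs) = w" "set (y # xs) \<subseteq> A" "path_edges (y # xs) \<subseteq> E"
    by blast
  show ?case
  proof (cases "x \<in> set (y # xs)")
    case True
    then obtain l r where lr: "y # xs = l @ x # r" by (metis split_list)
    then show ?thesis
      using xs path_edges_append[of l x r] by (intro exI[of _ r]) (auto simp: lr)
  next
    case False
    then show ?thesis using xs step by (intro exI[of _ "y # xs"]) auto
  qed
qed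

text \<open>The minimality of \<open>C\<close> makes the graph on \<open>insert v0 C\<close> 2-connected.\<close>

locale end_block =
  fixes V :: "'a set" and E :: "'a set set" and v0 :: 'a and C :: "'a set"
  assumes finV: "finite V" and E_verts: "\<And>e. e \<in> E \<Longrightarrow> e \<subseteq> V \<and> card e = 2"
    and v0V: "v0 \<in> V" and CV: "C \<subseteq> V" and v0C: "v0 \<notin> C"
    and closed: "\<And>w z. w \<in> C \<Longrightarrow> {w, z} \<in> E \<Longrightarrow> z \<in> insert v0 C"
    and min: "\<And>x y. x \<in> V \<Longrightarrow> y \<in> V - {x} \<Longrightarrow> card C \<le> card (reach E (V - {x}) y)"
begin

abbreviation "B \<equiv> insert v0 C"

lemma BV: "B \<subseteq> V" using v0V CV by auto

lemma finC: "finite C" using finV CV finite_subset by blast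

text \<open>Suppose the component \<open>W\<close> of \<open>w\<close> in \<open>B - U\<close> is
  attached to \<open>U\<close> at no vertex but \<open>x\<close>. Deleting \<open>x\<close> then
  cuts off \<open>W\<close> if \<open>v0\<close> is not in it, and otherwise a part of
  \<open>C\<close> outside \<open>W\<close>. Either way a set smaller than \<open>C\<close> is cut
  off, against \<open>min\<close>.\<close>

lemma two_attachments:
  assumes U: "U \<subseteq> B" "2 \<le> card U" and w: "w \<in> B" "w \<notin> U"
  shows "\<exists>x1 x2 z1 z2. x1 \<noteq> x2 \<and> x1 \<in> U \<and> x2 \<in> U \<and> z1 \<in> reach E (B - U) w \<and> z2 \<in> reach E (B - U) w \<and>
    {x1, z1} \<in> E \<and> {x2, z2} \<in> E"
proof (rule ccontr)
  assume no: "\<not> ?thesis"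
  define W where "W = reach E (B - U) w"
  have WB: "W \<subseteq> B - U" using reach_subset[of w "B - U" E] w by (auto simp: W_def)
  have "U \<noteq> {}" using U(2) by auto
  obtain x where x: "x \<in> U" "\<And>x' z. x' \<in> U \<Longrightarrow> z \<in> W \<Longrightarrow> {x', z} \<in> E \<Longrightarrow> x' = x"
  proof (cases "\<exists>x\<in>U. \<exists>z\<in>W. {x, z} \<in> E")
    case True
    then obtain x z where "x \<in> U" "z \<in> W" "{x, z} \<in> E" by auto
    then show ?thesis using that[of x] no unfolding W_def by metis
  next
    case False
    then show ?thesis using that \<open>U \<noteq> {}\<close> by blast
  qed
  \<comment> \<open>The second vertex of \<open>U\<close> makes \<open>W\<close> a proper subset of
    \<open>C\<close> in the first case below and is the start of the small component in the
    second.\<close>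
  obtain y where y: "y \<in> U" "y \<noteq> x"
  proof -
    have "\<not> U \<subseteq> {x}" using U(2) card_mono[of "{x}" U] by auto
    then show ?thesis using that by blast
  qed
  have xV: "x \<in> V" using x(1) U(1) BV by blast
  show False
  proof (cases "v0 \<in> W")
    case False
    have "reach E (V - {x}) w \<subseteq> W"
    proof
      fix z assume "z \<in> reach E (V - {x}) w"
      then show "z \<in> W"
      proof (induction rule: reach_induct)
        case refl
        then show ?case by (simp add: W_def reach_refl)
      next
        case (step z z')
        then have "z \<in> C" using WB False by auto
        then have z': "z' \<in> B" using closed step(2) by blast
        have "z' \<notin> U" using x(2)[of z' z] step by (auto simp: insert_commute)
        then show ?case using reach_step[of z E "B - U" w z'] step WB z' by (auto simp: W_def)
      qed
    qed
    moreover have WC: "W \<subset> C"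
    proof -
      have "W \<subseteq> C" using WB False by auto
      moreover have "x \<in> C \<or> y \<in> C" using x y U(1) by blast
      ultimately show ?thesis using WB x(1) y(1) by blast
    qed
    ultimately have "reach E (V - {x}) w \<subset> C" by blast
    then have "card (reach E (V - {x}) w) < card C" by (rule psubset_card_mono[OF finC])
    moreover have "w \<in> V - {x}" using w x BV by blast
    ultimately show False using min[OF xV, of w] by simp
  next
    case True
    then have UC: "U \<subseteq> C" using WB U(1) by blast
    have "reach E (V - {x}) y \<subseteq> C - W - {x}"
    proof
      fix z assume "z \<in> reach E (V - {x}) y"
      then show "z \<in> C - W - {x}"
      proof (induction rule: reach_induct)
        case refl
        then show ?case using y UC WB by blast
      next
        case (step z z')
        then have z': "z' \<in> B" using closed by blast
        have "z' \<notin> W"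
        proof
          assume z'W: "z' \<in> W"
          then have "z \<notin> U" using x(2)[of z z'] step by blast
          then have "z \<in> W"
            using reach_step[of z' E "B - U" w z] z'W WB step(1,2) by (auto simp: W_def insert_commute)
          then show False using step(1) by blast
        qed
        then show ?case using z' True step(4) by blast
      qed
    qed
    then have "reach E (V - {x}) y \<subset> C" using x(1) UC by blast
    then have "card (reach E (V - {x}) y) < card C" by (rule psubset_card_mono[OF finC])
    moreover have "y \<in> V - {x}" using y U(1) BV by blast
    ultimately show False using min[OF xV, of y] by simp
  qed
qed

lemma ear_through:
  assumes U: "U \<subseteq> B" "2 \<le> card U" and w: "w \<in> B" "w \<notin> U"
  shows "\<exists>a b zs. distinct (a # b # zs) \<and> zs \<noteq> [] \<and> a \<in> U \<and> b \<in> U \<and> set zs \<subseteq> B - U \<and> path_edges (a # zs @ [b]) \<subseteq> E"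
proof -
  obtain x1 x2 z1 z2 where x: "x1 \<noteq> x2" "x1 \<in> U" "x2 \<in> U" "z1 \<in> reach E (B - U) w" "z2 \<in> reach E (B - U) w"
    "{x1, z1} \<in> E" "{x2, z2} \<in> E" using two_attachments[OF assms] by blast
  have "z2 \<in> reach E (B - U) z1" using reach_trans[OF reach_sym[OF x(4)] x(5)] .
  moreover have "z2 \<in> B - U" using reach_subset[of w "B - U" E] x(5) w by auto
  ultimately obtain xs where xs: "distinct (z1 # xs)" "last (z1 # xs) = z2" "set (z1 # xs) \<subseteq> B - U"
    "path_edges (z1 # xs) \<subseteq> E" using reach_path by metis
  obtain ys where ys: "z1 # xs = ys @ [z2]" using xs(2) by (metis append_butlast_last_id list.distinct(1))
  have "path_edges (x1 # (z1 # xs) @ [x2]) = insert {x1, z1} (path_edges ((z1 # xs) @ [x2]))"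
    by simp
  also have "path_edges ((z1 # xs) @ [x2]) = path_edges (ys @ [z2, x2])"
    unfolding ys by simp
  also have "path_edges (ys @ [z2, x2]) = path_edges (z1 # xs) \<union> {{z2, x2}}"
    using path_edges_append[of ys z2 "[x2]"] ys by simp
  finally have "path_edges (x1 # (z1 # xs) @ [x2]) \<subseteq> E" using xs(4) x(6,7) by (auto simp: insert_commute)
  then show ?thesis
    using xs x by (intro exI[of _ x1] exI[of _ x2] exI[of _ "z1 # xs"]) auto
qed

text \<open>Take the largest edge set with \<open>P\<close> inside the block. A missing edge with
  both ends covered is an ear without inner vertices; otherwise some vertex is not covered and
  \<open>ear_through\<close> passes an ear through it. Both contradict maximality.\<close>

lemma ear_induct:
  assumes big: "3 \<le> card B" and edge: "\<exists>e\<in>E. e \<subseteq> B"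
    and base: "\<And>D. circuit D \<Longrightarrow> D \<subseteq> E \<Longrightarrow> P D"
    and ear: "\<And>H a b zs. P H \<Longrightarrow> distinct (a # b # zs) \<Longrightarrow> set zs \<inter> \<Union>H = {} \<Longrightarrow>
      path_edges (a # zs @ [b]) \<inter> H = {} \<Longrightarrow> path_edges (a # zs @ [b]) \<subseteq> E \<Longrightarrow>
      a \<in> \<Union>H \<Longrightarrow> b \<in> \<Union>H \<Longrightarrow> P (H \<union> path_edges (a # zs @ [b]))"
  shows "P {e \<in> E. e \<subseteq> B}"
proof -
  let ?EB = "{e \<in> E. e \<subseteq> B}"
  have "?EB \<subseteq> Pow V" using BV by auto
  then have fin: "finite ?EB" using finV by (meson finite_Pow_iff finite_subset)
  have sub_EB: "path_edges (a # zs @ [b]) \<subseteq> ?EB"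
    if "a \<in> B" "b \<in> B" "set zs \<subseteq> B" "path_edges (a # zs @ [b]) \<subseteq> E" for a b zs
    using that Union_path_edges_subset[of "a # zs @ [b]"] by auto
  let ?Q = "\<lambda>H. P H \<and> H \<subseteq> ?EB \<and> H \<noteq> {}"
  have "\<exists>H. ?Q H"
  proof -
    obtain x y where xy: "{x, y} \<in> E" "{x, y} \<subseteq> B" "x \<noteq> y"
      using edge E_verts by (metis card_2_iff)
    have "\<not> B \<subseteq> {x, y}" using big xy(3) card_mono[of "{x, y}" B] by auto
    then obtain w where w: "w \<in> B" "w \<notin> {x, y}" by blast
    obtain a b zs where z: "distinct (a # b # zs)" "zs \<noteq> []" "a \<in> {x, y}" "b \<in> {x, y}" "set zs \<subseteq> B - {x, y}"
      "path_edges (a # zs @ [b]) \<subseteq> E"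
      using ear_through[OF xy(2) _ w] xy(3) by auto
    have ab: "{a, b} = {x, y}" using z by auto
    \<comment> \<open>An ear on the two ends of one edge closes up with that edge to a first
      circuit; the empty list stands for the edge itself.\<close>
    let ?D = "path_edges (a # zs @ [b]) \<union> path_edges (a # [] @ [b])"
    have "circuit ?D" using circuit_join[of a b zs "[]"] z by simp
    moreover have "?D \<subseteq> ?EB"
      using sub_EB[of a b zs] z xy ab by auto
    ultimately show ?thesis using base[of ?D] by (intro exI[of _ ?D]) auto
  qed
  then obtain H0 where "?Q H0" by blast
  moreover have "\<forall>H. ?Q H \<longrightarrow> card H < Suc (card ?EB)"
    using card_mono[OF fin] by (simp add: less_Suc_eq_le)
  ultimately have "\<exists>H. ?Q H \<and> (\<forall>H'. ?Q H' \<longrightarrow> card H' \<le> card H)"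
    by (rule Lattices_Big.ex_has_greatest_nat)
  then obtain H where H: "?Q H" "\<And>H'. ?Q H' \<Longrightarrow> card H' \<le> card H" by blast
  have "H = ?EB"
  proof (rule ccontr)
    assume "H \<noteq> ?EB"
    then obtain e where e: "e \<in> E" "e \<subseteq> B" "e \<notin> H" using H(1) by blast
    let ?U = "\<Union>H"
    have UB: "?U \<subseteq> B" using H(1) by blast
    have finH: "finite H" using H(1) fin finite_subset by blast
    have c2: "2 \<le> card ?U"
    proof -
      obtain f where f: "f \<in> H" using H(1) by blast
      then have "card f = 2" using H(1) E_verts by blast
      moreover have "card f \<le> card ?U"
        using f finC UB by (intro card_mono) (auto intro: finite_subset)
      ultimately show ?thesis by simp
    qed
    obtain a b zs where z: "distinct (a # b # zs)" "a \<in> ?U" "b \<in> ?U" "set zs \<subseteq> B - ?U"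
      "path_edges (a # zs @ [b]) \<subseteq> E" "path_edges (a # zs @ [b]) \<inter> H = {}"
    proof (cases "e \<subseteq> ?U")
      case True
      obtain a b where "e = {a, b}" "a \<noteq> b" using E_verts[OF e(1)] by (metis card_2_iff)
      then show ?thesis using that[of a b "[]"] e True by auto
    next
      case False
      then obtain w where w: "w \<in> B" "w \<notin> ?U" using e by blast
      obtain a b zs where z: "distinct (a # b # zs)" "zs \<noteq> []" "a \<in> ?U" "b \<in> ?U" "set zs \<subseteq> B - ?U"
        "path_edges (a # zs @ [b]) \<subseteq> E" using ear_through[OF UB c2 w] by blast
      have "path_edges (a # zs @ [b]) \<inter> H = {}"
      proof (rule ccontr)
        assume "path_edges (a # zs @ [b]) \<inter> H \<noteq> {}"
        then obtain f where f: "f \<in> path_edges (a # zs @ [b])" "f \<in> H" by blast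
        have "f \<subseteq> {a, b}" using f z(5) Union_path_edges_subset[of "a # zs @ [b]"] by auto
        moreover have "card f = 2" using f H(1) E_verts by blast
        ultimately have "f = {a, b}" using z(1)
          by (metis card_2_iff card_subset_eq distinct_length_2_or_more finite.emptyI finite_insert)
        then show False using ends_edge_path_edges[of a zs b] z f by auto
      qed
      then show ?thesis using that z by blast
    qed
    let ?H = "H \<union> path_edges (a # zs @ [b])"
    have "P ?H" using ear[of H a b zs] z H(1) by blast
    moreover have "?H \<subseteq> ?EB" using H(1) sub_EB[of a b zs] z UB by blast
    ultimately have "card ?H \<le> card H" using H by blast
    moreover have "path_edges (a # zs @ [b]) \<noteq> {}" by (cases zs) auto
    ultimately show False using z(6) finH by (simp add: card_Un_disjoint Int_commute)
  qed
  then show ?thesis using H(1) by simp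
qed

end

lemma end_block_exists:
  assumes finV: "finite V" and E: "\<And>e. e \<in> E \<Longrightarrow> e \<subseteq> V \<and> card e = 2" and uv: "u \<in> V" "v \<in> V" "u \<noteq> v"
  obtains v0 C where "end_block V E v0 C" "C \<noteq> {}"
proof -
  let ?Q = "\<lambda>(x, y). x \<in> V \<and> y \<in> V - {x}"
  let ?c = "\<lambda>(x, y). card (reach E (V - {x}) y)"
  have "?Q (u, v)" using uv by auto
  then obtain q where q: "?Q q" "\<And>r. ?Q r \<Longrightarrow> ?c q \<le> ?c r"
    using ex_has_least_nat[of ?Q "(u, v)" ?c] by blast
  obtain v0 y where qv: "q = (v0, y)" by (cases q)
  let ?C = "reach E (V - {v0}) y"
  have sub: "?C \<subseteq> V - {v0}" using q(1) qv reach_subset[of y "V - {v0}" E] by auto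
  have "end_block V E v0 ?C"
  proof
    fix w z assume wz: "w \<in> ?C" "{w, z} \<in> E"
    show "z \<in> insert v0 ?C"
      using reach_step[of w E "V - {v0}" y z] wz sub E[OF wz(2)] by auto
  next
    fix x y' assume "x \<in> V" "y' \<in> V - {x}"
    then show "card ?C \<le> card (reach E (V - {x}) y')" using q(2)[of "(x, y')"] qv by auto
  qed (use finV E q(1) qv sub in auto)
  moreover have "?C \<noteq> {}" using reach_refl by fast
  ultimately show ?thesis using that by blast
qed

section \<open>Discharging\<close>

lemma double_count:
  "finite A \<Longrightarrow> finite B \<Longrightarrow> (\<Sum>a\<in>A. card {b \<in> B. P a b}) = (\<Sum>b\<in>B. card {a \<in> A. P a b})"
  using sum.swap_restrict[of A B "\<lambda>_ _. 1 :: nat" P] by simp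

text \<open>The hypotheses describe an end block of a graph of minimum degree 3 without light edges.
  Degrees are counted in the block, so nothing is assumed at \<open>v0\<close>, which may have
  further edges outside. Every chord of a 5-cycle joins vertices at distance two on it, so the
  single chord \<open>ac\<close> in \<open>no_net\<close> covers all 5-nets.\<close>

locale discharging =
  fixes E :: "'a set set" and F :: "'f set" and bd :: "'f \<Rightarrow> 'a set set" and v0 :: 'a
    and deg :: "'a \<Rightarrow> nat"
  defines "deg v \<equiv> card {e \<in> E. v \<in> e}"
  assumes fs: "facial_system E F bd" and card_edge: "\<And>e. e \<in> E \<Longrightarrow> card e = 2"
    and deg_ge3: "\<And>v. v \<in> \<Union>E \<Longrightarrow> v \<noteq> v0 \<Longrightarrow> 3 \<le> deg v"
    and nbr_deg3: "\<And>u v. {u, v} \<in> E \<Longrightarrow> u \<noteq> v0 \<Longrightarrow> v \<noteq> v0 \<Longrightarrow> deg u = 3 \<Longrightarrow> 7 \<le> deg v"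
    and nbr_deg4: "\<And>u v. {u, v} \<in> E \<Longrightarrow> u \<noteq> v0 \<Longrightarrow> v \<noteq> v0 \<Longrightarrow> deg u = 4 \<Longrightarrow> 6 \<le> deg v"
    and no_net: "\<And>a b c x y. distinct [a, b, c, x, y] \<Longrightarrow> {a, b} \<in> E \<Longrightarrow> {b, c} \<in> E \<Longrightarrow> {c, x} \<in> E \<Longrightarrow>
      {x, y} \<in> E \<Longrightarrow> {y, a} \<in> E \<Longrightarrow> {a, c} \<in> E \<Longrightarrow> False"
begin

lemma finE: "finite E" and finF: "finite F"
  using fs by (auto simp: facial_system_def)

lemma bd_circuit: "R \<in> F \<Longrightarrow> circuit (bd R)" and bd_sub: "R \<in> F \<Longrightarrow> bd R \<subseteq> E"
  using fs by (auto simp: facial_system_def)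

lemma two_faces: "e \<in> E \<Longrightarrow> card {R \<in> F. e \<in> bd R} = 2"
  using fs by (auto simp: facial_system_def)

lemma finV: "finite (\<Union>E)"
  using finE card_edge by (metis card.infinite finite_Union zero_neq_numeral)

lemma pair: "R \<in> F \<Longrightarrow> S \<in> F \<Longrightarrow> R \<noteq> S \<Longrightarrow> e \<in> bd R \<Longrightarrow> e \<in> bd S \<Longrightarrow> Q \<in> F \<Longrightarrow> e \<in> bd Q \<Longrightarrow> Q = R \<or> Q = S"
proof (rule ccontr)
  assume a: "R \<in> F" "S \<in> F" "R \<noteq> S" "e \<in> bd R" "e \<in> bd S" "Q \<in> F" "e \<in> bd Q" "\<not> (Q = R \<or> Q = S)"
  then have "card {R, S, Q} \<le> card {R \<in> F. e \<in> bd R}" using finF by (intro card_mono) auto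
  moreover have "e \<in> E" using a(1,4) bd_sub by blast
  ultimately show False using two_faces a by auto
qed

lemma other_face:
  assumes "R \<in> F" "e \<in> bd R"
  obtains S where "S \<in> F" "S \<noteq> R" "e \<in> bd S"
proof -
  have "\<not> {R \<in> F. e \<in> bd R} \<subseteq> {R}"
  proof
    assume "{R \<in> F. e \<in> bd R} \<subseteq> {R}"
    then have "card {R \<in> F. e \<in> bd R} \<le> card {R}" by (intro card_mono) auto
    moreover have "e \<in> E" using bd_sub assms by blast
    ultimately show False using two_faces by simp
  qed
  then show ?thesis using that by blast
qed

text \<open>The way to read off a degree from faces: walking around \<open>v\<close> from face to
  face never leaves \<open>X\<close>, and since the rotation is one cycle, \<open>X\<close> contains
  all edges at \<open>v\<close>.\<close>

lemma closed_rotation: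
  assumes "X \<subseteq> {e \<in> E. v \<in> e}" "X \<noteq> {}"
    "\<And>R e f. R \<in> F \<Longrightarrow> e \<in> X \<Longrightarrow> e \<in> bd R \<Longrightarrow> f \<in> bd R \<Longrightarrow> v \<in> f \<Longrightarrow> f \<in> X"
  shows "deg v = card X"
proof -
  have "\<not> X \<subset> {e \<in> E. v \<in> e}"
  proof
    assume "X \<subset> {e \<in> E. v \<in> e}"
    then obtain R e f where "R \<in> F" "e \<in> X" "f \<in> {e \<in> E. v \<in> e} - X" "e \<in> bd R" "f \<in> bd R"
      using fs assms(2) unfolding facial_system_def by meson
    then show False using assms(3)[of R e f] by blast
  qed
  then have "X = {e \<in> E. v \<in> e}" using assms(1) by blast
  then show ?thesis by (simp add: deg_def)
qed

definition N :: "'a \<Rightarrow> 'a set" where "N v = {u \<in> \<Union>E. {v, u} \<in> E}"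

lemma finN: "finite (N v)"
  by (rule finite_subset[OF _ finV]) (auto simp: N_def)

lemma card_N: "card (N v) = deg v"
proof -
  have "bij_betw (\<lambda>u. {v, u}) (N v) {e \<in> E. v \<in> e}"
  proof (rule bij_betw_imageI)
    show "inj_on (\<lambda>u. {v, u}) (N v)" by (auto simp: inj_on_def doubleton_eq_iff)
    show "(\<lambda>u. {v, u}) ` N v = {e \<in> E. v \<in> e}"
    proof (intro equalityI subsetI)
      fix e assume e: "e \<in> {e \<in> E. v \<in> e}"
      then obtain x y where "e = {x, y}" using card_edge by (metis (lifting) card_2_iff mem_Collect_eq)
      then obtain u where "e = {v, u}" using e by blast
      moreover from this have "u \<in> \<Union>E" "{v, u} \<in> E" using e by auto
      ultimately show "e \<in> (\<lambda>u. {v, u}) ` N v" unfolding N_def by blast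
    qed (auto simp: N_def)
  qed
  then show ?thesis by (simp add: deg_def bij_betw_same_card)
qed

text \<open>Count pairs of an edge at \<open>v\<close> and a face containing it: each edge is on two
  faces, and each face at \<open>v\<close>, being bounded by a circuit, has two edges there.\<close>

lemma card_faces_at: "card {R \<in> F. v \<in> \<Union>(bd R)} = deg v"
proof -
  let ?E = "{e \<in> E. v \<in> e}" and ?F = "{R \<in> F. v \<in> \<Union>(bd R)}"
  have "(\<Sum>e\<in>?E. card {R \<in> ?F. e \<in> bd R}) = 2 * card ?F"
  proof (rule sum_multicount)
    show "\<forall>R\<in>?F. card {e \<in> ?E. e \<in> bd R} = 2"
    proof
      fix R assume R: "R \<in> ?F"
      then obtain u w where uw: "u \<noteq> w" "v \<noteq> u" "v \<noteq> w" "{e \<in> bd R. v \<in> e} = {{v, u}, {v, w}}"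
        using circuit_at[OF bd_circuit, of R v] by blast
      have "{e \<in> ?E. e \<in> bd R} = {e \<in> bd R. v \<in> e}" using R bd_sub by blast
      then show "card {e \<in> ?E. e \<in> bd R} = 2" using uw by (simp add: doubleton_eq_iff)
    qed
  qed (use finE finF in auto)
  moreover have "card {R \<in> ?F. e \<in> bd R} = 2" if "e \<in> ?E" for e
  proof -
    have "{R \<in> ?F. e \<in> bd R} = {R \<in> F. e \<in> bd R}" using that by blast
    then show ?thesis using two_faces that by simp
  qed
  ultimately show ?thesis by (simp add: deg_def)
qed

section \<open>Triangular faces and the faces next to them\<close>

definition tri :: "'f \<Rightarrow> bool" where "tri R \<longleftrightarrow> R \<in> F \<and> card (bd R) = 3"
definition big :: "'f \<Rightarrow> bool" where "big R \<longleftrightarrow> R \<in> F \<and> 5 \<le> card (bd R)"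
text \<open>On a live face every vertex has degree at least 3 and \<open>v0\<close> is not a
  3-vertex, so the local arguments below apply. Triangles that are not live contain
  \<open>v0\<close>, which pays for them alone.\<close>

definition live :: "'f \<Rightarrow> bool" where "live R \<longleftrightarrow> \<not> (v0 \<in> \<Union>(bd R) \<and> deg v0 \<le> 3)"
definition beside_tri :: "'a set \<Rightarrow> 'f \<Rightarrow> bool" where
  "beside_tri e R \<longleftrightarrow> (\<exists>S. tri S \<and> S \<noteq> R \<and> e \<in> bd S)"
text \<open>The number of sides across which a triangle receives charge from a long face.\<close>

definition tau :: "'f \<Rightarrow> nat" where "tau R = card {e \<in> bd R. \<exists>S. big S \<and> e \<in> bd S}"

lemma triE:
  assumes "tri R" "a \<in> \<Union>(bd R)"
  obtains b c where "distinct [a, b, c]" "bd R = {{a, b}, {b, c}, {c, a}}" "\<Union>(bd R) = {a, b, c}"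
    "{a, b} \<in> E" "{b, c} \<in> E" "{c, a} \<in> E"
proof -
  obtain b c where b: "distinct [a, b, c]" "bd R = {{a, b}, {b, c}, {c, a}}"
    using circuit3[OF bd_circuit, of R a] assms unfolding tri_def by blast
  moreover have "\<Union>(bd R) = {a, b, c}" using b by auto
  moreover have "bd R \<subseteq> E" using assms bd_sub by (simp add: tri_def)
  ultimately show ?thesis using that by simp
qed

lemma triE2:
  assumes "tri R" "{a, b} \<in> bd R"
  obtains c where "distinct [a, b, c]" "bd R = {{a, b}, {b, c}, {c, a}}" "\<Union>(bd R) = {a, b, c}"
    "{a, b} \<in> E" "{b, c} \<in> E" "{c, a} \<in> E"
proof -
  obtain x y where x: "distinct [a, x, y]" "bd R = {{a, x}, {x, y}, {y, a}}" "\<Union>(bd R) = {a, x, y}"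
    "{a, x} \<in> E" "{x, y} \<in> E" "{y, a} \<in> E" using triE[OF assms(1), of a] assms(2) by blast
  have "b = x \<or> b = y" using assms(2) x(1,2) by (auto simp: doubleton_eq_iff)
  then show ?thesis
  proof
    assume "b = x" then show ?thesis using that[of y] x by simp
  next
    assume "b = y"
    then show ?thesis using that[of x] x by (auto simp: insert_commute)
  qed
qed

lemma live_deg:
  assumes "R \<in> F" "live R" "v \<in> \<Union>(bd R)"
  shows "3 \<le> deg v" "deg v \<le> 3 \<Longrightarrow> v \<noteq> v0"
  using assms deg_ge3[of v] bd_sub[of R] unfolding live_def by (cases "v = v0"; auto)+

text \<open>Each of the two faces has only \<open>va\<close> and \<open>vb\<close> at
  \<open>v\<close>, and these edges lie on no other face, so the rotation at \<open>v\<close> closes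
  after two edges.\<close>

lemma deg2_of_two_faces:
  assumes RS: "R \<in> F" "S \<in> F" "R \<noteq> S"
    and e: "{v, a} \<in> bd R" "{v, a} \<in> bd S" "{v, b} \<in> bd R" "{v, b} \<in> bd S" "a \<noteq> b" "v \<noteq> a" "v \<noteq> b"
  shows "deg v = 2"
proof -
  have c2: "{e \<in> bd Q. v \<in> e} = {{v, a}, {v, b}}" if "Q = R \<or> Q = S" for Q
  proof -
    have Q: "Q \<in> F" "{v, a} \<in> bd Q" "{v, b} \<in> bd Q" using that assms by auto
    have "v \<in> \<Union>(bd Q)" using Q(2) by blast
    then obtain u w where uw: "u \<noteq> w" "v \<noteq> u" "v \<noteq> w" "{e \<in> bd Q. v \<in> e} = {{v, u}, {v, w}}"
      by (rule circuit_at[OF bd_circuit[OF Q(1)]])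
    have "{v, a} \<in> {e \<in> bd Q. v \<in> e}" "{v, b} \<in> {e \<in> bd Q. v \<in> e}" using Q by simp_all
    then have "a = u \<or> a = w" "b = u \<or> b = w" unfolding uw(4) by (auto simp: doubleton_eq_iff)
    then show ?thesis using uw(4) e(5) by (auto simp: insert_commute)
  qed
  have "deg v = card {{v, a}, {v, b}}"
  proof (rule closed_rotation)
    show "{{v, a}, {v, b}} \<subseteq> {e \<in> E. v \<in> e}" using e bd_sub RS by blast
    fix Q x f assume Q: "Q \<in> F" "x \<in> {{v, a}, {v, b}}" "x \<in> bd Q" "f \<in> bd Q" "v \<in> f"
    then have "Q = R \<or> Q = S" using pair[OF RS, of x Q] e by blast
    then show "f \<in> {{v, a}, {v, b}}" using c2[of Q] Q by blast
  qed simp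
  then show ?thesis using e(5-7) by (simp add: doubleton_eq_iff)
qed

lemma tri_beside_tri:
  assumes R: "tri R" "live R" "bd R = {{a, b}, {b, c}, {c, a}}" "distinct [a, b, c]"
    and S: "tri S" "S \<noteq> R" "{a, b} \<in> bd S"
  obtains x where "x \<notin> {a, b, c}" "bd S = {{a, b}, {b, x}, {x, a}}" "{b, x} \<in> E" "{x, a} \<in> E"
proof -
  obtain x where x: "distinct [a, b, x]" "bd S = {{a, b}, {b, x}, {x, a}}" "\<Union>(bd S) = {a, b, x}"
    "{a, b} \<in> E" "{b, x} \<in> E" "{x, a} \<in> E"
    by (rule triE2[OF S(1,3)])
  have "x \<noteq> c"
  proof
    assume "x = c"
    then have "bd S = {{a, b}, {b, c}, {c, a}}" using x(2) by simp
    moreover have "{a, c} = {c, a}" by blast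
    ultimately have m: "{a, b} \<in> bd R" "{a, b} \<in> bd S" "{a, c} \<in> bd R" "{a, c} \<in> bd S"
      unfolding R(3) by simp_all
    have "deg a = 2"
      by (rule deg2_of_two_faces[OF _ _ S(2)[symmetric] m]) (use R(1,4) S(1) in \<open>auto simp: tri_def\<close>)
    then show False using live_deg(1)[of R a] R by (auto simp: tri_def)
  qed
  then have "x \<notin> {a, b, c}" using x(1) by auto
  then show ?thesis by (rule that[OF _ x(2,5,6)])
qed

text \<open>If the third vertex \<open>c\<close> is off the 4-face \<open>abxy\<close>, then
  \<open>a c b x y\<close> is a 5-cycle with chord \<open>ab\<close>. If it is on that face,
  \<open>a\<close> or \<open>b\<close> has degree 2.\<close>

lemma tri_not_beside_quad:
  assumes R: "tri R" "live R" "{a, b} \<in> bd R" and S: "S \<in> F" "{a, b} \<in> bd S"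
  shows "card (bd S) \<noteq> 4"
proof
  assume 4: "card (bd S) = 4"
  obtain c where c: "distinct [a, b, c]" "bd R = {{a, b}, {b, c}, {c, a}}" "\<Union>(bd R) = {a, b, c}"
    "{a, b} \<in> E" "{b, c} \<in> E" "{c, a} \<in> E" using triE2[OF R(1,3)] .
  obtain x y where x: "distinct [a, b, x, y]" "bd S = {{a, b}, {b, x}, {x, y}, {y, a}}"
    using circuit4[OF bd_circuit[OF S(1)] 4 S(2)] c(1) by auto
  have xE: "{b, x} \<in> E" "{x, y} \<in> E" "{y, a} \<in> E" using bd_sub[OF S(1)] x(2) by auto
  have RF: "R \<in> F" "R \<noteq> S" using R(1) 4 by (auto simp: tri_def)
  consider "c = x" | "c = y" | "c \<noteq> x" "c \<noteq> y" by blast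
  then show False
  proof cases
    case 1
    then have "deg b = 2"
      using deg2_of_two_faces[OF RF(1) S(1) RF(2), of b a c] c x by (auto simp: insert_commute)
    then show False using live_deg(1)[OF RF(1) R(2), of b] c by auto
  next
    case 2
    then have "deg a = 2"
      using deg2_of_two_faces[OF RF(1) S(1) RF(2), of a b c] c x by (auto simp: insert_commute)
    then show False using live_deg(1)[OF RF(1) R(2), of a] c by auto
  next
    case 3
    show False
      by (rule no_net[of a c b x y]) (use 3 c x xE in \<open>auto simp: insert_commute\<close>)
  qed
qed

text \<open>Two triangles beside a third one share their third vertex, for otherwise the five vertices
  form a net.\<close>

lemma two_beside_tri:
  assumes R: "tri R" "live R" "bd R = {{a, b}, {b, c}, {c, a}}" "distinct [a, b, c]"
    and S: "beside_tri {a, b} R" "beside_tri {b, c} R"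
  shows "deg b = 3"
proof -
  obtain S1 S2 where S: "tri S1" "S1 \<noteq> R" "{a, b} \<in> bd S1" "tri S2" "S2 \<noteq> R" "{b, c} \<in> bd S2"
    using S by (auto simp: beside_tri_def)
  obtain x where x: "x \<notin> {a, b, c}" "bd S1 = {{a, b}, {b, x}, {x, a}}" "{b, x} \<in> E" "{x, a} \<in> E"
    using tri_beside_tri[OF R S(1-3)] .
  have "bd R = {{b, c}, {c, a}, {a, b}}" "distinct [b, c, a]" using R by auto
  then obtain y where y: "y \<notin> {b, c, a}" "bd S2 = {{b, c}, {c, y}, {y, b}}" "{c, y} \<in> E" "{y, b} \<in> E"
    using tri_beside_tri[OF R(1,2) _ _ S(4-6)] by metis
  have RE: "{a, b} \<in> E" "{b, c} \<in> E" "{c, a} \<in> E" using R(1,3) bd_sub[of R] by (auto simp: tri_def)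
  have "x = y"
  proof (rule ccontr)
    assume "x \<noteq> y"
    \<comment> \<open>With distinct tips, \<open>c y b x a\<close> is a 5-cycle with chord
      \<open>bc\<close>.\<close>
    then show False
      using no_net[of c y b x a] x y R(4) RE by (auto simp: insert_commute)
  qed
  have FF: "R \<in> F" "S1 \<in> F" "S2 \<in> F" using R S by (auto simp: tri_def)
  have "S1 \<noteq> S2"
  proof
    assume "S1 = S2"
    then have "c \<in> \<Union>(bd S1)" using S(6) by auto
    then show False using x(1,2) R(4) by auto
  qed
  have cm: "{a, b} = {b, a}" "{x, b} = {b, x}" by blast+
  \<comment> \<open>With a common tip \<open>x\<close>, the triangles \<open>abc\<close>,
    \<open>abx\<close> and \<open>bcx\<close> close up around \<open>b\<close>.\<close>
  have "deg b = card {{a, b}, {b, c}, {b, x}}"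
  proof (rule closed_rotation)
    show "{{a, b}, {b, c}, {b, x}} \<subseteq> {e \<in> E. b \<in> e}" using RE x by auto
    fix Q e f assume Q: "Q \<in> F" "e \<in> {{a, b}, {b, c}, {b, x}}" "e \<in> bd Q" "f \<in> bd Q" "b \<in> f"
    have "Q = R \<or> Q = S1 \<or> Q = S2"
    proof -
      have "Q = R \<or> Q = S1" if "e = {a, b}"
        using pair[OF FF(1,2) S(2)[symmetric], of e Q] Q that R(3) S(3) by auto
      moreover have "Q = R \<or> Q = S2" if "e = {b, c}"
        using pair[OF FF(1,3) S(5)[symmetric], of e Q] Q that R(3) S(6) by auto
      moreover have "Q = S1 \<or> Q = S2" if "e = {b, x}"
        using pair[OF FF(2,3) \<open>S1 \<noteq> S2\<close>, of e Q] Q that x(2) y(2) \<open>x = y\<close> by (auto simp: insert_commute)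
      ultimately show ?thesis using Q(2) by blast
    qed
    then have "f \<in> {{a, b}, {b, c}, {c, a}} \<or> f \<in> {{a, b}, {b, x}, {x, a}} \<or> f \<in> {{b, c}, {c, x}, {x, b}}"
      using Q(4) R(3) x(2) y(2) \<open>x = y\<close> by metis
    moreover have "b \<notin> {c, a}" "b \<notin> {x, a}" "b \<notin> {c, x}" using R(4) x(1) by auto
    ultimately show "f \<in> {{a, b}, {b, c}, {b, x}}" using Q(5) cm(2) by (metis insert_iff)
  qed simp
  also have "{{a, b}, {b, c}, {b, x}} = (\<lambda>u. {b, u}) ` {a, c, x}" unfolding cm(1) by simp
  also have "card \<dots> = card {a, c, x}"
    by (rule card_image) (auto simp: inj_on_def doubleton_eq_iff)
  also have "\<dots> = 3" using R(4) x(1) by (auto simp: card_insert_if)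
  finally show ?thesis .
qed

lemma tri_nonempty: "tri R \<Longrightarrow> \<exists>a. a \<in> \<Union>(bd R)"
  using circuit_card(1)[OF bd_circuit, of R] unfolding tri_def
  by (metis all_not_in_conv card.empty zero_neq_numeral)

lemma beside_big_or_tri:
  assumes "tri R" "live R" "e \<in> bd R"
  shows "beside_tri e R \<or> (\<exists>S. big S \<and> e \<in> bd S)"
proof -
  have RF: "R \<in> F" using assms by (simp add: tri_def)
  obtain S where S: "S \<in> F" "S \<noteq> R" "e \<in> bd S" using other_face[OF RF assms(3)] .
  obtain a b where ab: "e = {a, b}"
    using card_edge bd_sub[OF RF] assms(3) by (metis card_2_iff subsetD)
  have "card (bd S) \<noteq> 4" using tri_not_beside_quad[of R a b S] assms S ab by simp
  moreover have "3 \<le> card (bd S)" using circuit_card(2)[OF bd_circuit[OF S(1)]] .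
  ultimately have "card (bd S) = 3 \<or> 5 \<le> card (bd S)" by linarith
  then show ?thesis using S by (auto simp: beside_tri_def tri_def big_def)
qed

text \<open>A side not on a long face borders a triangle, as 4-faces are excluded. Two such sides
  share a vertex, and \<open>two_beside_tri\<close> makes it a 3-vertex.\<close>

lemma tau_lt2:
  assumes R: "tri R" "live R" "tau R < 2"
  obtains b where "b \<in> \<Union>(bd R)" "deg b = 3" "\<forall>e\<in>bd R. b \<in> e \<longrightarrow> beside_tri e R"
proof -
  define X where "X = {e \<in> bd R. \<exists>S. big S \<and> e \<in> bd S}"
  obtain a where "a \<in> \<Union>(bd R)" using tri_nonempty[OF R(1)] by blast
  then obtain b c where b: "distinct [a, b, c]" "bd R = {{a, b}, {b, c}, {c, a}}" "\<Union>(bd R) = {a, b, c}"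
    using triE[OF R(1)] by metis
  have ne: "{a, b} \<noteq> {b, c}" "{b, c} \<noteq> {c, a}" "{c, a} \<noteq> {a, b}"
    using b(1) by (auto simp: doubleton_eq_iff)
  have two: "\<not> (e \<in> X \<and> f \<in> X)" if "e \<noteq> f" for e f
  proof
    assume "e \<in> X \<and> f \<in> X"
    then have "card {e, f} \<le> card X" using b(2) by (intro card_mono) (auto simp: X_def)
    then show False using that R(3) by (simp add: tau_def X_def)
  qed
  have bes: "beside_tri e R" if "e \<in> bd R" "e \<notin> X" for e
    using beside_big_or_tri[OF R(1,2) that(1)] that by (auto simp: X_def)
  have inR: "{a, b} \<in> bd R" "{b, c} \<in> bd R" "{c, a} \<in> bd R" using b(2) by auto
  consider "{a, b} \<notin> X" "{b, c} \<notin> X" | "{b, c} \<notin> X" "{c, a} \<notin> X" | "{c, a} \<notin> X" "{a, b} \<notin> X"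
    using two[OF ne(1)] two[OF ne(2)] two[OF ne(3)] by blast
  then show ?thesis
  proof cases
    case 1
    then have "beside_tri {a, b} R" "beside_tri {b, c} R" using bes inR by auto
    moreover from this have "deg b = 3" by (rule two_beside_tri[OF R(1,2) b(2,1)])
    ultimately show ?thesis using that[of b] b by auto
  next
    case 2
    then have "beside_tri {b, c} R" "beside_tri {c, a} R" using bes inR by auto
    moreover from this have "deg c = 3"
      by (rule two_beside_tri[OF R(1,2), rotated 2]) (use b in auto)
    ultimately show ?thesis using that[of c] b by auto
  next
    case 3
    then have "beside_tri {c, a} R" "beside_tri {a, b} R" using bes inR by auto
    moreover from this have "deg a = 3"
      by (rule two_beside_tri[OF R(1,2), rotated 2]) (use b in auto)
    ultimately show ?thesis using that[of a] b by auto
  qed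
qed

text \<open>\<open>v0\<close> is excluded because its degree in the block may be smaller than in the
  graph, so its neighbours need not have large degree.\<close>

definition deg3 :: "'a \<Rightarrow> bool" where "deg3 v \<longleftrightarrow> v \<noteq> v0 \<and> deg v = 3"
definition low :: "'a \<Rightarrow> bool" where "low v \<longleftrightarrow> v \<noteq> v0 \<and> deg v \<le> 4"

lemma deg3_low: "deg3 v \<Longrightarrow> low v"
  by (simp add: deg3_def low_def)

lemma nbr_low: "{u, v} \<in> E \<Longrightarrow> low u \<Longrightarrow> v \<noteq> v0 \<Longrightarrow> 6 \<le> deg v"
proof -
  assume a: "{u, v} \<in> E" "low u" "v \<noteq> v0"
  then have "u \<in> \<Union>E" by blast
  then have "deg u = 3 \<or> deg u = 4" using deg_ge3[of u] a(2) by (auto simp: low_def)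
  then show ?thesis using nbr_deg3[of u v] nbr_deg4[of u v] a by (auto simp: low_def)
qed

lemma nbr_low': "{u, v} \<in> E \<Longrightarrow> low u \<Longrightarrow> \<not> low v"
  using nbr_low[of u v] by (auto simp: low_def)

lemma nbr_3: "{u, v} \<in> E \<Longrightarrow> deg3 u \<Longrightarrow> v \<noteq> v0 \<Longrightarrow> 7 \<le> deg v"
  using nbr_deg3[of u v] by (auto simp: deg3_def)

lemma tau_lt2':
  assumes "tri R" "live R" "tau R < 2"
  obtains b where "b \<in> \<Union>(bd R)" "deg3 b" "\<forall>e\<in>bd R. b \<in> e \<longrightarrow> beside_tri e R"
proof -
  obtain b where b: "b \<in> \<Union>(bd R)" "deg b = 3" "\<forall>e\<in>bd R. b \<in> e \<longrightarrow> beside_tri e R"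
    by (rule tau_lt2[OF assms])
  moreover have "b \<noteq> v0" using live_deg(2)[of R b] assms b(1,2) by (simp add: tri_def)
  ultimately show ?thesis using that by (simp add: deg3_def)
qed

text \<open>With no side on a long face, two corners would have degree 3; but they are adjacent and
  differ from \<open>v0\<close>, whereas neighbours of 3-vertices have degree at least 7.\<close>

lemma tau_ge1:
  assumes R: "tri R" "live R"
  shows "1 \<le> tau R"
proof (rule ccontr)
  assume "\<not> 1 \<le> tau R"
  then have 0: "tau R = 0" by simp
  obtain b where b: "b \<in> \<Union>(bd R)" "deg3 b" using tau_lt2'[OF R] 0 by (metis zero_less_numeral)
  obtain c a where c: "distinct [b, c, a]" "bd R = {{b, c}, {c, a}, {a, b}}" "{b, c} \<in> E"
    using triE[OF R(1) b(1)] by metis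
  have "finite {e \<in> bd R. \<exists>S. big S \<and> e \<in> bd S}" using c(2) by simp
  then have none: "{e \<in> bd R. \<exists>S. big S \<and> e \<in> bd S} = {}" using 0 by (simp add: tau_def)
  moreover have inR: "{b, c} \<in> bd R" "{c, a} \<in> bd R" using c(2) by simp_all
  ultimately have "beside_tri {b, c} R" "beside_tri {c, a} R"
    using beside_big_or_tri[OF R inR(1)] beside_big_or_tri[OF R inR(2)] by blast+
  then have "deg c = 3" using two_beside_tri[OF R c(2,1)] by simp
  moreover have "c \<noteq> v0" using live_deg(2)[of R c] R calculation c(2) by (auto simp: tri_def)
  ultimately show False using nbr_3[OF c(3) b(2)] by simp
qed

text \<open>All charges are multiplied by 120. A face of length at least 5 gives 24 across each edge to a
  triangle, a vertex of degree 3 receives 40 from each neighbour, and \<open>pay v R\<close> is what the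
  triangle \<open>R\<close> receives from its vertex \<open>v\<close>. The exceptional vertex \<open>v0\<close> may end up with
  negative charge, but above -960.\<close>

definition pay :: "'a \<Rightarrow> 'f \<Rightarrow> int" where
  "pay v R =
    (if \<not> live R then (if v = v0 then 120 else 0)
     else if low v then 0
     else if v = v0 then 48
     else if \<exists>u\<in>\<Union>(bd R). low u then (if 2 \<le> tau R then 36 else 48)
     else 24)"

lemma pay_nonneg: "0 \<le> pay v R"
  by (simp add: pay_def)

text \<open>The origin of the amounts in \<open>pay\<close>. Low vertices are not adjacent, so a
  triangle with a low vertex has two payers: \<open>tau = 1\<close> leaves 120 - 24 = 2 * 48 to pay,
  \<open>tau = 2\<close> leaves 120 - 48 = 2 * 36. Without a low vertex \<open>tau\<close> is at
  least 2, and three vertices share 72 = 3 * 24.\<close>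

lemma triangle_paid:
  assumes R: "tri R"
  shows "120 \<le> (\<Sum>v\<in>\<Union>(bd R). pay v R) + 24 * int (tau R)"
proof (cases "live R")
  case False
  then have "v0 \<in> \<Union>(bd R)" by (simp add: live_def)
  moreover have "finite (\<Union>(bd R))" using R circuit_card(4)[OF bd_circuit] by (simp add: tri_def)
  ultimately have "pay v0 R \<le> (\<Sum>v\<in>\<Union>(bd R). pay v R)"
    by (intro member_le_sum) (auto simp: pay_nonneg)
  then show ?thesis using False by (simp add: pay_def)
next
  case live: True
  show ?thesis
  proof (cases "\<exists>a\<in>\<Union>(bd R). low a")
    case True
    then obtain a where a: "a \<in> \<Union>(bd R)" "low a" by blast
    obtain b c where b: "distinct [a, b, c]" "\<Union>(bd R) = {a, b, c}" "{a, b} \<in> E" "{c, a} \<in> E"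
      using triE[OF R a(1)] by metis
    have n: "\<not> low b" "\<not> low c" using nbr_low'[of a b] nbr_low'[of a c] b a by (auto simp: insert_commute)
    have p: "(if 2 \<le> tau R then 36 else 48) \<le> pay v R" if "\<not> low v" for v
      using that live True by (auto simp: pay_def)
    have "(\<Sum>v\<in>\<Union>(bd R). pay v R) = pay a R + pay b R + pay c R" using b by simp
    moreover have "1 \<le> tau R" using tau_ge1[OF R live] .
    ultimately show ?thesis using p[OF n(1)] p[OF n(2)] pay_nonneg[of a R] by (auto split: if_splits)
  next
    case False
    have t: "2 \<le> tau R"
    proof (rule ccontr)
      assume "\<not> 2 \<le> tau R"
      then show False using tau_lt2'[OF R live] False deg3_low by (metis not_le)
    qed
    obtain a where a: "a \<in> \<Union>(bd R)" using tri_nonempty[OF R] by blast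
    obtain b c where b: "distinct [a, b, c]" "\<Union>(bd R) = {a, b, c}"
      using triE[OF R a(1)] by metis
    have p: "24 \<le> pay v R" if "v \<in> \<Union>(bd R)" for v
      using that live False by (auto simp: pay_def)
    have "(\<Sum>v\<in>\<Union>(bd R). pay v R) = pay a R + pay b R + pay c R" using b by simp
    then show ?thesis using p[of a] p[of b] p[of c] b(2) t by simp
  qed
qed

section \<open>What the vertices pay\<close>

definition T :: "'a \<Rightarrow> 'f set" where "T v = {R. tri R \<and> v \<in> \<Union>(bd R)}"

lemma finT: "finite (T v)" and card_T: "card (T v) \<le> deg v"
proof -
  have s: "T v \<subseteq> {R \<in> F. v \<in> \<Union>(bd R)}" by (auto simp: T_def tri_def)
  have f: "finite {R \<in> F. v \<in> \<Union>(bd R)}" using finF by simp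
  show "finite (T v)" by (rule finite_subset[OF s f])
  show "card (T v) \<le> deg v" using card_mono[OF f s] card_faces_at[of v] by simp
qed

lemma sum_pay_le:
  assumes "\<And>R. R \<in> T v \<Longrightarrow> pay v R \<le> c" "0 \<le> c"
  shows "(\<Sum>R\<in>T v. pay v R) \<le> c * int (deg v)"
proof -
  have "(\<Sum>R\<in>T v. pay v R) \<le> int (card (T v)) * c" using sum_bounded_above[of "T v" "pay v" c] assms by simp
  also have "\<dots> \<le> c * int (deg v)" using card_T[of v] assms(2) by (simp add: mult.commute mult_left_mono)
  finally show ?thesis .
qed

lemma T_nbr: "R \<in> T v \<Longrightarrow> u \<in> \<Union>(bd R) \<Longrightarrow> u \<noteq> v \<Longrightarrow> {u, v} \<in> E"
proof -
  assume a: "R \<in> T v" "u \<in> \<Union>(bd R)" "u \<noteq> v"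
  then have "tri R" "v \<in> \<Union>(bd R)" by (auto simp: T_def)
  then obtain b c where "\<Union>(bd R) = {v, b, c}" "{v, b} \<in> E" "{c, v} \<in> E" using triE by metis
  then show ?thesis using a by (auto simp: insert_commute)
qed

text \<open>The part of \<open>pay v R\<close> that is charged to the edge \<open>vu\<close>. Together with the 40 for a 3-vertex
  \<open>u\<close>, each edge bears at most 51, which is less than \<open>120 (d - 4) / d\<close> for \<open>d \<ge> 7\<close>.\<close>

definition share :: "'a \<Rightarrow> 'a \<Rightarrow> 'f \<Rightarrow> int" where
  "share v u R =
    (if \<not> live R then 0
     else if deg3 u then (if card {S. tri S \<and> {v, u} \<in> bd S} = 1 then 11 else 0)
     else if \<exists>w\<in>\<Union>(bd R). deg3 w \<and> card {S. tri S \<and> {v, w} \<in> bd S} = 1 then 25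
     else if \<exists>w\<in>\<Union>(bd R). deg3 w then 48
     else 18)"

lemma tris_at: "finite {S. tri S \<and> e \<in> bd S}" "card {S. tri S \<and> e \<in> bd S} \<le> 2"
proof -
  have s: "{S. tri S \<and> e \<in> bd S} \<subseteq> {S \<in> F. e \<in> bd S}" by (auto simp: tri_def)
  then show "finite {S. tri S \<and> e \<in> bd S}" using finF by (auto intro: finite_subset)
  show "card {S. tri S \<and> e \<in> bd S} \<le> 2"
  proof (cases "e \<in> E")
    case True
    then show ?thesis using card_mono[OF _ s] two_faces[OF True] finF by simp
  next
    case False
    then have "{S. tri S \<and> e \<in> bd S} = {}" using bd_sub by (auto simp: tri_def)
    then show ?thesis by (metis card.empty zero_le)
  qed
qed

lemma beside_iff_card:
  assumes "tri R" "e \<in> bd R"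
  shows "beside_tri e R \<longleftrightarrow> card {S. tri S \<and> e \<in> bd S} \<noteq> 1"
proof
  assume "beside_tri e R"
  then obtain S where S: "tri S" "S \<noteq> R" "e \<in> bd S" by (auto simp: beside_tri_def)
  show "card {S. tri S \<and> e \<in> bd S} \<noteq> 1"
  proof
    assume "card {S. tri S \<and> e \<in> bd S} = 1"
    then obtain x where "{S. tri S \<and> e \<in> bd S} = {x}" by (rule card_1_singletonE)
    then have "S = x" "R = x" using S assms by blast+
    then show False using S(2) by simp
  qed
next
  assume c: "card {S. tri S \<and> e \<in> bd S} \<noteq> 1"
  show "beside_tri e R"
  proof (rule ccontr)
    assume "\<not> beside_tri e R"
    then have "{S. tri S \<and> e \<in> bd S} = {R}" using assms by (auto simp: beside_tri_def)
    then show False using c by simp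
  qed
qed

text \<open>If the edge from \<open>v\<close> to a 3-vertex lies on only one triangle, then
  \<open>tau R\<close> is at least 2 and the payment 36 splits as 11 + 25; the edge already bears
  40. If it lies on two triangles, it bears none of the 48. Without a 3-vertex, 36 splits evenly as
  18 + 18.\<close>

lemma pay_le_share:
  assumes v: "7 \<le> deg v" "v \<noteq> v0" and R: "tri R"
    and b: "distinct [v, u, w]" "bd R = {{v, u}, {u, w}, {w, v}}" "\<Union>(bd R) = {v, u, w}"
      "{v, u} \<in> E" "{u, w} \<in> E" "{w, v} \<in> E"
  shows "pay v R \<le> share v u R + share v w R"
proof (cases "live R")
  case False
  then show ?thesis using v by (simp add: pay_def share_def)
next
  case live: True
  have nv: "\<not> low v" "\<not> deg3 v" using v by (auto simp: low_def deg3_def)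
  have p48: "pay v R \<le> 48" "2 \<le> tau R \<Longrightarrow> pay v R \<le> 36" using live nv v by (auto simp: pay_def)
  have asym: "pay v R \<le> share v u R + share v w R"
    if u: "deg3 u" and b: "distinct [v, u, w]" "bd R = {{v, u}, {u, w}, {w, v}}" "\<Union>(bd R) = {v, u, w}"
      "{u, w} \<in> E" for u w
  proof -
    have nw: "\<not> deg3 w" using nbr_low'[OF b(4)] u deg3_low by blast
    have bR: "{v, u} \<in> bd R" using b(2) by simp
    show ?thesis
    proof (cases "card {S. tri S \<and> {v, u} \<in> bd S} = 1")
      case True
      have "2 \<le> tau R"
      proof (rule ccontr)
        assume "\<not> 2 \<le> tau R"
        then obtain x where x: "x \<in> \<Union>(bd R)" "deg3 x" "\<forall>e\<in>bd R. x \<in> e \<longrightarrow> beside_tri e R"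
          using tau_lt2'[OF R live] by (metis not_le)
        then have "x = u" using b(3) nv nw by auto
        then have "beside_tri {v, u} R" using x(3) bR by simp
        then show False using True beside_iff_card[OF R bR] by simp
      qed
      moreover have "share v u R = 11" using live u True by (simp add: share_def)
      moreover have "share v w R = 25" using live nw u True b(3) by (auto simp: share_def)
      ultimately show ?thesis using p48 by simp
    next
      case False
      have "\<not> (\<exists>x\<in>\<Union>(bd R). deg3 x \<and> card {S. tri S \<and> {v, x} \<in> bd S} = 1)"
        using b(3) nv nw False by auto
      moreover have "\<exists>x\<in>\<Union>(bd R). deg3 x" using b(3) u by auto
      ultimately have "share v w R = 48" using live nw by (simp add: share_def)
      moreover have "0 \<le> share v u R" by (simp add: share_def)
      ultimately show ?thesis using p48 by simp
    qed
  qed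
  consider "deg3 u" | "deg3 w" | "\<not> deg3 u" "\<not> deg3 w" by blast
  then show ?thesis
  proof cases
    case 1
    then show ?thesis using asym[of u w] b by simp
  next
    case 2
    have "bd R = {{v, w}, {w, u}, {u, v}}" "\<Union>(bd R) = {v, w, u}" "{w, u} \<in> E" "distinct [v, w, u]"
      using b(1,2,3,5) by (auto simp: insert_commute)
    then show ?thesis using asym[OF 2, of u] by simp
  next
    case 3
    then have no: "\<not> (\<exists>x\<in>\<Union>(bd R). deg3 x)" using b(3) nv by auto
    then have "2 \<le> tau R" using tau_lt2'[OF R live] by (metis not_le)
    moreover have "share v u R = 18" "share v w R = 18" using live 3 no by (auto simp: share_def)
    ultimately show ?thesis using p48 by simp
  qed
qed

text \<open>At a 3-vertex \<open>u\<close> the load is at most 40 + 11. Otherwise one triangle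
  contributes at most 48, and two contribute at most 25 each: a share of 48 from one of two
  triangles on \<open>vu\<close> would make both sides of that triangle at \<open>v\<close> border
  triangles, forcing \<open>deg v = 3\<close>.\<close>

lemma share_at_nbr:
  assumes v: "7 \<le> deg v" "v \<noteq> v0"
  shows "(\<Sum>R | tri R \<and> {v, u} \<in> bd R. share v u R) + (if deg3 u then 40 else 0) \<le> 51"
proof -
  let ?A = "{R. tri R \<and> {v, u} \<in> bd R}"
  have nv: "\<not> deg3 v" using v by (auto simp: deg3_def)
  have A: "finite ?A" "card ?A \<le> 2" by (rule tris_at)+
  show ?thesis
  proof (cases "deg3 u")
    case True
    have "(\<Sum>R\<in>?A. share v u R) \<le> int (card ?A) * (if card ?A = 1 then 11 else 0)"
      by (rule sum_bounded_above) (use True in \<open>auto simp: share_def\<close>)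
    also have "\<dots> \<le> 11" by auto
    finally show ?thesis using True by simp
  next
    case False
    have s48: "share v u R \<le> 48" for R using False by (simp add: share_def)
    consider "card ?A \<le> 1" | "card ?A = 2" using A(2) by linarith
    then have "(\<Sum>R\<in>?A. share v u R) \<le> 50"
    proof cases
      case 1
      have "(\<Sum>R\<in>?A. share v u R) \<le> int (card ?A) * 48"
        by (rule sum_bounded_above) (use s48 in simp)
      then show ?thesis using 1 by simp
    next
      case 2
      have "share v u R \<le> 25" if R: "R \<in> ?A" for R
      proof (rule ccontr)
        assume big: "\<not> share v u R \<le> 25"
        have live: "live R" using big unfolding share_def by (rule contrapos_np) simp
        have "\<exists>w\<in>\<Union>(bd R). deg3 w" using big live False by (auto simp: share_def split: if_splits)
        then obtain w where w: "w \<in> \<Union>(bd R)" "deg3 w" by blast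
        then have cw: "card {S. tri S \<and> {v, w} \<in> bd S} \<noteq> 1"
          using big live False by (auto simp: share_def split: if_splits)
        have tR: "tri R" "{v, u} \<in> bd R" using R by auto
        obtain c where c: "distinct [v, u, c]" "bd R = {{v, u}, {u, c}, {c, v}}" "\<Union>(bd R) = {v, u, c}"
          using triE2[OF tR] by metis
        have "w = c" using w c(3) nv False by auto
        then have "beside_tri {c, v} R"
          using beside_iff_card[OF tR(1), of "{v, w}"] cw c(2) by (simp add: insert_commute)
        moreover have "beside_tri {v, u} R" using beside_iff_card[OF tR] 2 by simp
        ultimately have "deg v = 3"
          using two_beside_tri[OF tR(1) live, of c v u] c by (auto simp: insert_commute)
        then show False using v by simp
      qed
      then have "(\<Sum>R\<in>?A. share v u R) \<le> int (card ?A) * 25"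
        by (intro sum_bounded_above) blast
      then show ?thesis using 2 by simp
    qed
    then show ?thesis using False by simp
  qed
qed

lemma vertex_pays_ge7:
  assumes v: "7 \<le> deg v" "v \<noteq> v0"
  shows "(\<Sum>R\<in>T v. pay v R) + 40 * int (card {u \<in> N v. deg3 u}) \<le> 51 * int (deg v)"
proof -
  have "(\<Sum>R\<in>T v. pay v R) \<le> (\<Sum>R\<in>T v. \<Sum>u | u \<in> N v \<and> {v, u} \<in> bd R. share v u R)"
  proof (rule sum_mono)
    fix R assume R: "R \<in> T v"
    then have tR: "tri R" "v \<in> \<Union>(bd R)" by (auto simp: T_def)
    obtain u w where b: "distinct [v, u, w]" "bd R = {{v, u}, {u, w}, {w, v}}" "\<Union>(bd R) = {v, u, w}"
      "{v, u} \<in> E" "{u, w} \<in> E" "{w, v} \<in> E" using triE[OF tR] .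
    have "{x. x \<in> N v \<and> {v, x} \<in> bd R} = {u, w}"
      using b by (auto simp: N_def doubleton_eq_iff insert_commute)
    then have "(\<Sum>x | x \<in> N v \<and> {v, x} \<in> bd R. share v x R) = share v u R + share v w R"
      using b(1) by simp
    then show "pay v R \<le> (\<Sum>x | x \<in> N v \<and> {v, x} \<in> bd R. share v x R)"
      using pay_le_share[OF v tR(1) b] by simp
  qed
  also have "\<dots> = (\<Sum>u\<in>N v. \<Sum>R | R \<in> T v \<and> {v, u} \<in> bd R. share v u R)"
    by (rule sum.swap_restrict[OF finT finN])
  also have "\<dots> = (\<Sum>u\<in>N v. \<Sum>R | tri R \<and> {v, u} \<in> bd R. share v u R)"
    by (intro sum.cong) (auto simp: T_def)
  finally have 1: "(\<Sum>R\<in>T v. pay v R) \<le> (\<Sum>u\<in>N v. \<Sum>R | tri R \<and> {v, u} \<in> bd R. share v u R)" .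
  have "40 * int (card {u \<in> N v. deg3 u}) = (\<Sum>u\<in>N v. if deg3 u then 40 else 0)"
    using finN by (simp flip: sum.inter_filter)
  then have "(\<Sum>R\<in>T v. pay v R) + 40 * int (card {u \<in> N v. deg3 u}) \<le>
    (\<Sum>u\<in>N v. (\<Sum>R | tri R \<and> {v, u} \<in> bd R. share v u R) + (if deg3 u then 40 else 0))"
    using 1 by (simp add: sum.distrib)
  also have "\<dots> \<le> int (card (N v)) * 51"
    by (rule sum_bounded_above) (rule share_at_nbr[OF v])
  finally show ?thesis by (simp add: card_N)
qed

text \<open>A 5-vertex has no low neighbours except possibly \<open>v0\<close>, which does not count
  as low, and spends at most 5 * 24 = 120. A 6-vertex has no 3-vertex as neighbour, hence meets no
  live triangle with \<open>tau < 2\<close>, and spends at most 6 * 36 = 216 out of 240. The extra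
  120 on the right is what a 3-vertex gets from its three neighbours.\<close>

lemma vertex_pays:
  assumes vV: "v \<in> \<Union>E" and v: "v \<noteq> v0"
  shows "(\<Sum>R\<in>T v. pay v R) + 40 * int (card {u \<in> N v. deg3 u})
    \<le> 120 * (int (deg v) - 4) + (if deg3 v then 120 else 0)"
proof -
  have no3: "{u \<in> N v. deg3 u} = {}" if "deg v < 7"
    using that nbr_3[of _ v] v by (auto simp: N_def insert_commute)
  then have c0: "card {u \<in> N v. deg3 u} = 0" if "deg v < 7"
    using that by (simp only: card.empty)
  have low0: "pay v R = 0" if "low v" for R unfolding pay_def using that v by simp
  have nolow: "\<not> low u" if "deg v < 6" "R \<in> T v" "u \<in> \<Union>(bd R)" "\<not> low v" for u R
    using that T_nbr[of R v u] nbr_low[of u v] v by (cases "u = v") auto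
  consider "deg v = 3" | "deg v = 4" | "deg v = 5" | "deg v = 6" | "7 \<le> deg v"
    using deg_ge3[OF vV v] by linarith
  then show ?thesis
  proof cases
    case 1
    then have "deg3 v" "low v" using v by (simp_all add: deg3_def low_def)
    then show ?thesis using c0 low0 1 by simp
  next
    case 2
    then have "\<not> deg3 v" "low v" using v by (simp_all add: deg3_def low_def)
    then show ?thesis using c0 low0 2 by simp
  next
    case 3
    have "pay v R \<le> 24" if "R \<in> T v" for R
    proof -
      have "\<not> low v" using 3 by (simp add: low_def)
      then show ?thesis using nolow[of R] that 3 v by (auto simp: pay_def)
    qed
    then have "(\<Sum>R\<in>T v. pay v R) \<le> 24 * int (deg v)" by (intro sum_pay_le) auto
    moreover have "\<not> deg3 v" using 3 by (simp add: deg3_def)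
    ultimately show ?thesis using c0 3 by simp
  next
    case 4
    have "pay v R \<le> 36" if R: "R \<in> T v" for R
    proof (rule ccontr)
      assume "\<not> pay v R \<le> 36"
      then have "live R" "\<not> 2 \<le> tau R" using v by (auto simp: pay_def split: if_splits)
      moreover have "tri R" using R by (simp add: T_def)
      ultimately obtain b where b: "b \<in> \<Union>(bd R)" "deg3 b" using tau_lt2' by (metis not_le)
      have "b \<noteq> v" using b 4 by (auto simp: deg3_def)
      then show False using nbr_3[OF T_nbr[OF R b(1)] b(2) v] 4 by simp
    qed
    then have "(\<Sum>R\<in>T v. pay v R) \<le> 36 * int (deg v)" by (intro sum_pay_le) auto
    moreover have "\<not> deg3 v" using 4 by (simp add: deg3_def)
    ultimately show ?thesis using c0 4 by simp
  next
    case 5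
    \<comment> \<open>Exactly here degree 7 is critical: 357 against 360.\<close>
    have "51 * int (deg v) \<le> 120 * (int (deg v) - 4)" using 5 by simp
    then show ?thesis using vertex_pays_ge7[OF 5 v] by simp
  qed
qed

text \<open>The slack 959 is the largest integer below 8 * 120, the amount by which the total charge
  is negative. The estimate is generous: at most 160 per edge for degree up to 3, and at most 88
  beyond.\<close>

lemma v0_pays:
  "(\<Sum>R\<in>T v0. pay v0 R) + 40 * int (card {u \<in> N v0. deg3 u}) \<le> 120 * (int (deg v0) - 4) + 959"
proof -
  have "card {u \<in> N v0. deg3 u} \<le> deg v0"
    using card_N[of v0] finN by (metis (no_types, lifting) card_mono mem_Collect_eq subsetI)
  moreover have "pay v0 R \<le> (if deg v0 \<le> 3 then 120 else 48)" if "R \<in> T v0" for R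
    using that by (auto simp: pay_def T_def live_def low_def)
  then have "(\<Sum>R\<in>T v0. pay v0 R) \<le> (if deg v0 \<le> 3 then 120 else 48) * int (deg v0)"
    by (intro sum_pay_le) auto
  ultimately show ?thesis by (auto split: if_splits)
qed

section \<open>Summing all charges\<close>

lemma sum_tau:
  "(\<Sum>R | tri R. tau R) \<le> (\<Sum>S | big S. card (bd S))"
proof -
  let ?E = "{e \<in> E. \<exists>S. big S \<and> e \<in> bd S}"
  have fin: "finite {R. tri R}" "finite {R. big R}"
    using finF by (auto simp: tri_def big_def)
  have "(\<Sum>R | tri R. tau R) = (\<Sum>R\<in>{R. tri R}. card {e \<in> ?E. e \<in> bd R})"
    using bd_sub by (intro sum.cong arg_cong[of _ _ card]) (auto simp: tau_def tri_def intro!: arg_cong[of _ _ card])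
  also have "\<dots> = (\<Sum>e\<in>?E. card {R \<in> {R. tri R}. e \<in> bd R})"
    by (rule double_count) (use fin finE in auto)
  also have "\<dots> \<le> (\<Sum>e\<in>?E. card {S \<in> {S. big S}. e \<in> bd S})"
  \<comment> \<open>An edge counted here has two faces, one of them long, so at most one is a
    triangle.\<close>
  proof (rule sum_mono)
    fix e assume e: "e \<in> ?E"
    let ?t = "{R \<in> {R. tri R}. e \<in> bd R}" and ?b = "{S \<in> {S. big S}. e \<in> bd S}"
    have fb: "finite ?t" "finite ?b" using fin by auto
    have "card ?t + card ?b = card (?t \<union> ?b)"
      by (rule card_Un_disjoint[symmetric]) (use fb in \<open>auto simp: tri_def big_def\<close>)
    also have "\<dots> \<le> card {R \<in> F. e \<in> bd R}"
      using finF by (intro card_mono) (auto simp: tri_def big_def)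
    also have "\<dots> = 2" using two_faces e by simp
    finally have "card ?t + card ?b \<le> 2" .
    moreover have "card ?b \<noteq> 0" using e fb by auto
    ultimately show "card ?t \<le> card ?b" by linarith
  qed
  also have "\<dots> = (\<Sum>S\<in>{S. big S}. card {e \<in> ?E. e \<in> bd S})"
    by (rule double_count[symmetric]) (use fin finE in auto)
  also have "\<dots> \<le> (\<Sum>S | big S. card (bd S))"
    by (intro sum_mono card_mono) (auto simp: big_def intro: circuit_card bd_circuit)
  finally show ?thesis .
qed

lemma sum_deg: "(\<Sum>v\<in>\<Union>E. deg v) = 2 * card E"
  unfolding deg_def
proof (rule sum_multicount)
  show "\<forall>e\<in>E. card {v \<in> \<Union>E. v \<in> e} = 2"
  proof
    fix e assume "e \<in> E"
    moreover from this have "{v \<in> \<Union>E. v \<in> e} = e" by auto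
    ultimately show "card {v \<in> \<Union>E. v \<in> e} = 2" using card_edge by simp
  qed
qed (use finE finV in auto)

lemma sum_bd: "(\<Sum>R\<in>F. card (bd R)) = 2 * card E"
proof -
  have "(\<Sum>R\<in>F. card {e \<in> E. e \<in> bd R}) = 2 * card E"
    by (rule sum_multicount) (use finE finF two_faces in auto)
  moreover have "{e \<in> E. e \<in> bd R} = bd R" if "R \<in> F" for R using bd_sub[OF that] by auto
  ultimately show ?thesis by simp
qed

theorem contradiction: False
proof -
  let ?V = "\<Union>E"
  have fin: "finite {R. tri R}" "finite {R. big R}"
    using finF by (auto simp: tri_def big_def)
  have euler: "card F + card ?V = card E + 2" using fs by (simp add: facial_system_def)
  have vsum: "(\<Sum>v\<in>?V. 120 * (int (deg v) - 4)) = 240 * int (card E) - 480 * int (card ?V)"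
  proof -
    have "(\<Sum>v\<in>?V. 120 * (int (deg v) - 4)) = 120 * (int (\<Sum>v\<in>?V. deg v) - (\<Sum>v\<in>?V. 4))"
      by (simp add: sum_subtractf flip: sum_distrib_left)
    then show ?thesis using sum_deg by simp
  qed
  have fsum: "(\<Sum>R\<in>F. 120 * (int (card (bd R)) - 4)) = 240 * int (card E) - 480 * int (card F)"
  proof -
    have "(\<Sum>R\<in>F. 120 * (int (card (bd R)) - 4)) = 120 * (int (\<Sum>R\<in>F. card (bd R)) - (\<Sum>R\<in>F. 4))"
      by (simp add: sum_subtractf flip: sum_distrib_left)
    then show ?thesis using sum_bd by simp
  qed
  have "(\<Sum>R | tri R. -120 + 24 * int (tau R)) \<le> (\<Sum>R | tri R. -120) + (\<Sum>R | big R. 24 * int (card (bd R)))"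
  proof -
    have "(\<Sum>R | tri R. 24 * int (tau R)) \<le> (\<Sum>R | big R. 24 * int (card (bd R)))"
      using sum_tau by (simp flip: sum_distrib_left of_nat_sum)
    then show ?thesis by (simp add: sum.distrib sum_subtractf)
  qed
  also have "\<dots> = (\<Sum>R\<in>F. if card (bd R) = 3 then -120 else 0) + (\<Sum>R\<in>F. if 5 \<le> card (bd R) then 24 * int (card (bd R)) else 0)"
    using finF by (simp add: tri_def big_def flip: sum.inter_filter)
  also have "\<dots> \<le> (\<Sum>R\<in>F. 120 * (int (card (bd R)) - 4))"
  proof -
    \<comment> \<open>Sending 24 across every side is affordable from length 5 on, with equality at
      5: 120 * (5 - 4) = 5 * 24.\<close>
    have "(if card (bd R) = 3 then -120 else 0) + (if 5 \<le> card (bd R) then 24 * int (card (bd R)) else 0)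
      \<le> 120 * (int (card (bd R)) - 4)" if "R \<in> F" for R
      using circuit_card(2)[OF bd_circuit[OF that]] by auto
    then show ?thesis unfolding sum.distrib[symmetric] by (rule sum_mono)
  qed
  finally have faces: "(\<Sum>R | tri R. -120 + 24 * int (tau R)) \<le> (\<Sum>R\<in>F. 120 * (int (card (bd R)) - 4))" .
  have "(\<Sum>R | tri R. 120 - 24 * int (tau R)) \<le> (\<Sum>R | tri R. \<Sum>v\<in>\<Union>(bd R). pay v R)"
    by (rule sum_mono) (use triangle_paid in \<open>auto simp: algebra_simps\<close>)
  also have "\<dots> = (\<Sum>R\<in>{R. tri R}. \<Sum>v | v \<in> ?V \<and> v \<in> \<Union>(bd R). pay v R)"
    using bd_sub by (intro sum.cong) (auto simp: tri_def)
  also have "\<dots> = (\<Sum>v\<in>?V. \<Sum>R | R \<in> {R. tri R} \<and> v \<in> \<Union>(bd R). pay v R)"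
    by (rule sum.swap_restrict[OF fin(1) finV])
  also have "\<dots> = (\<Sum>v\<in>?V. \<Sum>R\<in>T v. pay v R)" by (simp add: T_def)
  finally have tris: "(\<Sum>R | tri R. 120 - 24 * int (tau R)) \<le> (\<Sum>v\<in>?V. \<Sum>R\<in>T v. pay v R)" .
  \<comment> \<open>The transfers of 40 balance: each 3-vertex has exactly three neighbours, and
    \<open>v0\<close> pays like any other.\<close>
  have nbrs: "(\<Sum>v\<in>?V. 40 * int (card {u \<in> N v. deg3 u})) = (\<Sum>v\<in>?V. if deg3 v then 120 else 0)"
  proof -
    have "(\<Sum>v\<in>?V. card {u \<in> N v. deg3 u}) = (\<Sum>v\<in>?V. card {u \<in> ?V. {v, u} \<in> E \<and> deg3 u})"
      by (intro sum.cong arg_cong[of _ _ card]) (auto simp: N_def)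
    also have "\<dots> = (\<Sum>u\<in>?V. card {v \<in> ?V. {v, u} \<in> E \<and> deg3 u})"
      by (rule double_count[OF finV finV])
    also have "\<dots> = (\<Sum>u\<in>?V. if deg3 u then 3 else 0)"
    proof (rule sum.cong[OF refl])
      fix u
      have "{v \<in> ?V. {v, u} \<in> E \<and> deg3 u} = (if deg3 u then N u else {})"
        by (auto simp: N_def insert_commute)
      then show "card {v \<in> ?V. {v, u} \<in> E \<and> deg3 u} = (if deg3 u then 3 else 0)"
        using card_N[of u] by (simp add: deg3_def)
    qed
    finally have "(\<Sum>v\<in>?V. 40 * int (card {u \<in> N v. deg3 u})) = 40 * int (\<Sum>u\<in>?V. if deg3 u then 3 else 0)"
      by (simp flip: sum_distrib_left of_nat_sum)
    also have "\<dots> = (\<Sum>v\<in>?V. if deg3 v then 120 else 0)"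
      by (simp add: sum_distrib_left if_distrib cong: if_cong)
    finally show ?thesis .
  qed
  have "(\<Sum>v\<in>?V. (\<Sum>R\<in>T v. pay v R) + 40 * int (card {u \<in> N v. deg3 u}))
    \<le> (\<Sum>v\<in>?V. 120 * (int (deg v) - 4) + (if deg3 v then 120 else 0) + (if v = v0 then 959 else 0))"
  proof (rule sum_mono)
    fix v assume "v \<in> ?V"
    then show "(\<Sum>R\<in>T v. pay v R) + 40 * int (card {u \<in> N v. deg3 u})
      \<le> 120 * (int (deg v) - 4) + (if deg3 v then 120 else 0) + (if v = v0 then 959 else 0)"
      using vertex_pays[of v] v0_pays by (cases "v = v0") (auto simp: deg3_def)
  qed
  also have "\<dots> \<le> (\<Sum>v\<in>?V. 120 * (int (deg v) - 4)) + (\<Sum>v\<in>?V. if deg3 v then 120 else 0) + 959"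
    using finV by (simp add: sum.distrib)
  finally have "(\<Sum>v\<in>?V. \<Sum>R\<in>T v. pay v R) \<le> (\<Sum>v\<in>?V. 120 * (int (deg v) - 4)) + 959"
    using nbrs by (simp add: sum.distrib)
  moreover have "(\<Sum>R | tri R. -120 + 24 * int (tau R)) = - (\<Sum>R | tri R. 120 - 24 * int (tau R))"
    by (simp flip: sum_negf)
  ultimately have "0 \<le> (\<Sum>v\<in>?V. 120 * (int (deg v) - 4)) + (\<Sum>R\<in>F. 120 * (int (card (bd R)) - 4)) + 959"
    using faces tris by linarith
  then show False using vsum fsum euler by linarith
qed

end

section \<open>Light edges and the total graph\<close>

lemma degree_edges:
  assumes "finite_simple_graph G"
  shows "degree G v = card {e \<in> edges G. v \<in> e}"
proof -
  have "bij_betw (\<lambda>u. {v, u}) {u \<in> verts G. adj G v u} {e \<in> edges G. v \<in> e}"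
  proof (rule bij_betw_imageI)
    show "inj_on (\<lambda>u. {v, u}) {u \<in> verts G. adj G v u}" by (auto simp: inj_on_def doubleton_eq_iff)
    show "(\<lambda>u. {v, u}) ` {u \<in> verts G. adj G v u} = {e \<in> edges G. v \<in> e}"
    proof (intro equalityI subsetI)
      fix e assume e: "e \<in> {e \<in> edges G. v \<in> e}"
      then have "card e = 2" "e \<subseteq> verts G" using assms by (auto simp: finite_simple_graph_def)
      then obtain x y where "e = {x, y}" by (auto simp: card_2_iff)
      then obtain u where "e = {v, u}" using e by blast
      then show "e \<in> (\<lambda>u. {v, u}) ` {u \<in> verts G. adj G v u}"
        using e \<open>e \<subseteq> verts G\<close> by (auto simp: adj_def)
    qed (auto simp: adj_def)
  qed
  then show ?thesis by (simp add: degree_def bij_betw_same_card)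
qed

lemma net_of_five:
  assumes "distinct [a, b, c, x, y]" "{a, b, c, x, y} \<subseteq> verts G"
    "{a, b} \<in> edges G" "{b, c} \<in> edges G" "{c, x} \<in> edges G" "{x, y} \<in> edges G" "{y, a} \<in> edges G"
    "{a, c} \<in> edges G"
  shows "is_net 5 G [a, b, c, x, y]"
proof -
  have "{i. i < 5} = {0, 1, 2, 3, 4 :: nat}" by auto
  moreover have "cycle_edges [a, b, c, x, y] =
    (\<lambda>i. {[a, b, c, x, y] ! i, [a, b, c, x, y] ! (Suc i mod 5)}) ` {i. i < 5}"
    by (auto simp: cycle_edges_def)
  ultimately have ce: "cycle_edges [a, b, c, x, y] = {{a, b}, {b, c}, {c, x}, {x, y}, {y, a}}"
    by simp
  have "is_cycle G [a, b, c, x, y]"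
    unfolding is_cycle_def ce using assms by simp
  moreover have "is_chord G [a, b, c, x, y] {a, c}"
    unfolding is_chord_def ce using assms by (auto simp: doubleton_eq_iff)
  ultimately show ?thesis unfolding is_net_def by auto
qed

lemma light_edge:
  assumes G: "finite_simple_graph G" "planar G" "verts G \<noteq> {}"
    and net: "\<not> (\<exists>c. is_net 5 G c)"
    and deg: "\<And>v. v \<in> verts G \<Longrightarrow> 3 \<le> degree G v"
  shows "\<exists>u v. {u, v} \<in> edges G \<and>
    (degree G u = 3 \<and> degree G v \<le> 6 \<or> degree G u = 4 \<and> degree G v \<le> 5)"
proof (rule ccontr)
  assume no: "\<not> ?thesis"
  obtain p \<gamma> where "plane_drawing G p \<gamma>" using G(2) by (auto simp: planar_def)
  then interpret plane_drawn G p \<gamma> using G(1) by unfold_locales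
  have E: "e \<subseteq> verts G \<and> card e = 2" if "e \<in> edges G" for e
    using that G(1) by (auto simp: finite_simple_graph_def)
  have finV: "finite (verts G)" using G(1) by (simp add: finite_simple_graph_def)
  obtain u where u: "u \<in> verts G" using G(3) by blast
  have "\<not> verts G \<subseteq> {u}"
  proof
    assume "verts G \<subseteq> {u}"
    then have "degree G u \<le> card {u}" unfolding degree_def by (intro card_mono) auto
    then show False using deg[OF u] by simp
  qed
  then obtain v where v: "v \<in> verts G" "u \<noteq> v" by blast
  obtain v0 C where "end_block (verts G) (edges G) v0 C" and C: "C \<noteq> {}"
    using end_block_exists[OF finV E u v] by blast
  then interpret end_block "verts G" "edges G" v0 C by simp
  define EB where "EB = {e \<in> edges G. e \<subseteq> B}"
  \<comment> \<open>Edges at a vertex of \<open>C\<close> cannot leave the block, so only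
    \<open>v0\<close> may lose degree.\<close>
  have at: "{e \<in> EB. w \<in> e} = {e \<in> edges G. w \<in> e}" if w: "w \<in> C" for w
  proof -
    have "e \<subseteq> B" if e: "e \<in> edges G" "w \<in> e" for e
    proof -
      obtain x y where "e = {x, y}" using E[OF e(1)] by (auto simp: card_2_iff)
      then obtain z where "e = {w, z}" using e(2) by blast
      then show ?thesis using closed[OF w, of z] e(1) w by auto
    qed
    then show ?thesis by (auto simp: EB_def)
  qed
  have degC: "card {e \<in> EB. w \<in> e} = degree G w" if "w \<in> C" for w
    using at[OF that] degree_edges[OF G(1)] by simp
  obtain w where w: "w \<in> C" using C by blast
  then have wV: "w \<in> verts G" using CV by blast
  have "{x \<in> verts G. adj G w x} \<subseteq> B"
    using closed[OF w] by (auto simp: adj_def)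
  then have "card {x \<in> verts G. adj G w x} \<le> card B" using finC by (intro card_mono) auto
  then have big: "3 \<le> card B" using deg[OF wV] by (simp add: degree_def)
  have "{e \<in> EB. w \<in> e} \<noteq> {}" using degC[OF w] deg[OF wV] by (metis card.empty not_numeral_le_zero)
  then have edge: "\<exists>e\<in>edges G. e \<subseteq> B" by (auto simp: EB_def)
  have "\<exists>F bd. plane_faces EB F bd"
    unfolding EB_def
  proof (rule ear_induct[OF big edge])
    show "\<exists>F bd. plane_faces D F bd" if "circuit D" "D \<subseteq> edges G" for D
      using plane_faces_circuit that by blast
  qed (use plane_faces_ear in blast)
  then obtain F bd where "plane_faces EB F bd" by blast
  then have fs: "facial_system EB F bd" unfolding plane_faces_def by blast
  have inC: "w \<in> C" if "w \<in> \<Union>EB" "w \<noteq> v0" for w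
    using that by (auto simp: EB_def)
  have inE: "e \<in> edges G" if "e \<in> EB" for e using that by (simp add: EB_def)
  interpret discharging EB F bd v0 "\<lambda>v. card {e \<in> EB. v \<in> e}"
  proof unfold_locales
    show "facial_system EB F bd" by (rule fs)
    show "card e = 2" if "e \<in> EB" for e using that E by (simp add: EB_def)
    show "3 \<le> card {e \<in> EB. v \<in> e}" if "v \<in> \<Union>EB" "v \<noteq> v0" for v
      using degC[OF inC[OF that]] deg[of v] CV inC[OF that] by auto
    show "7 \<le> card {e \<in> EB. v \<in> e}"
      if h: "{u, v} \<in> EB" "u \<noteq> v0" "v \<noteq> v0" "card {e \<in> EB. u \<in> e} = 3" for u v
    proof -
      have "u \<in> C" "v \<in> C" using h inC by blast+
      then have "degree G u = 3" "card {e \<in> EB. v \<in> e} = degree G v" using degC h(4) by auto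
      then have "\<not> degree G v \<le> 6" using no inE[OF h(1)] by blast
      then show ?thesis using \<open>card {e \<in> EB. v \<in> e} = degree G v\<close> by simp
    qed
    show "6 \<le> card {e \<in> EB. v \<in> e}"
      if h: "{u, v} \<in> EB" "u \<noteq> v0" "v \<noteq> v0" "card {e \<in> EB. u \<in> e} = 4" for u v
    proof -
      have "u \<in> C" "v \<in> C" using h inC by blast+
      then have "degree G u = 4" "card {e \<in> EB. v \<in> e} = degree G v" using degC h(4) by auto
      then have "\<not> degree G v \<le> 5" using no inE[OF h(1)] by blast
      then show ?thesis using \<open>card {e \<in> EB. v \<in> e} = degree G v\<close> by simp
    qed
    show False if h: "distinct [a, b, c, x, y]" "{a, b} \<in> EB" "{b, c} \<in> EB" "{c, x} \<in> EB" "{x, y} \<in> EB"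
      "{y, a} \<in> EB" "{a, c} \<in> EB" for a b c x y
    proof -
      note e = h(2-7)[THEN inE]
      have "{a, b, c, x, y} \<subseteq> verts G" using e(1,3,5) E by blast
      then show ?thesis using net_of_five[OF h(1) _ e] net by blast
    qed
  qed
  show False by (rule contradiction)
qed

section \<open>Orderings as lists and the induction on the graph\<close>

fun back_degree_le :: "('b \<Rightarrow> 'b \<Rightarrow> bool) \<Rightarrow> nat \<Rightarrow> 'b list \<Rightarrow> bool" where
  "back_degree_le A m [] \<longleftrightarrow> True"
| "back_degree_le A m (x # xs) \<longleftrightarrow> back_degree_le A m xs \<and> card {u \<in> set xs. A x u} \<le> m"

lemma back_degree_le_mono:
  assumes "back_degree_le A m xs" "\<And>x y. x \<in> set xs \<Longrightarrow> y \<in> set xs \<Longrightarrow> A' x y \<Longrightarrow> A x y"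
  shows "back_degree_le A' m xs"
  using assms
proof (induction xs)
  case (Cons x xs)
  have "card {u \<in> set xs. A' x u} \<le> card {u \<in> set xs. A x u}"
    using Cons.prems(2) by (intro card_mono) auto
  then show ?case using Cons by auto
qed simp

lemma back_degree_le_filter:
  "back_degree_le A m xs \<Longrightarrow> back_degree_le A m (filter P xs)"
proof (induction xs)
  case (Cons x xs)
  have "card {u \<in> set (filter P xs). A x u} \<le> card {u \<in> set xs. A x u}"
    by (intro card_mono) auto
  then show ?case using Cons by auto
qed simp

text \<open>Lists are read backwards: the head comes last in the ordering and so gets the largest
  rank \<open>length xs\<close>; the tail keeps its ranks.\<close>

lemma ranking_of_list:
  assumes "distinct xs" "back_degree_le A m xs"
  shows "\<exists>r. bij_betw r (set xs) {..<length xs} \<and> (\<forall>v\<in>set xs. card {u \<in> set xs. A v u \<and> r u < r v} \<le> m)"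
  using assms
proof (induction xs)
  case Nil
  then show ?case by (simp add: bij_betw_def)
next
  case (Cons x xs)
  then obtain r where r: "bij_betw r (set xs) {..<length xs}"
    "\<And>v. v \<in> set xs \<Longrightarrow> card {u \<in> set xs. A v u \<and> r u < r v} \<le> m" by auto
  let ?r = "r(x := length xs)"
  have x: "x \<notin> set xs" using Cons.prems by simp
  have lt: "r v < length xs" if "v \<in> set xs" for v using r(1) that by (auto simp: bij_betw_def)
  have "bij_betw ?r (set xs) {..<length xs}"
    using r(1) x by (subst bij_betw_cong[of _ _ r]) auto
  then have "bij_betw ?r (set xs \<union> {x}) ({..<length xs} \<union> {length xs})"
    by (rule bij_betw_combine) (auto simp: bij_betw_def)
  moreover have "{..<length xs} \<union> {length xs} = {..<length (x # xs)}" by auto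
  ultimately have "bij_betw ?r (set (x # xs)) {..<length (x # xs)}" by simp
  moreover have "card {u \<in> set (x # xs). A v u \<and> ?r u < ?r v} \<le> m" if v: "v \<in> set (x # xs)" for v
  proof (cases "v = x")
    case True
    then have "{u \<in> set (x # xs). A v u \<and> ?r u < ?r v} = {u \<in> set xs. A x u}"
      using x lt by auto
    then show ?thesis using Cons.prems(2) by simp
  next
    case False
    then have v': "v \<in> set xs" using v by simp
    then have "{u \<in> set (x # xs). A v u \<and> ?r u < ?r v} = {u \<in> set xs. A v u \<and> r u < r v}"
      using x lt[OF v'] False by auto
    then show ?thesis using r(2)[OF v'] by simp
  qed
  ultimately show ?case by blast
qed

lemma col_le:
  assumes "distinct xs" "set xs = verts H" "back_degree_le (adj H) m xs"
  shows "col H \<le> Suc m"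
proof -
  obtain r where r: "bij_betw r (verts H) {..<card (verts H)}"
    "\<And>v. v \<in> verts H \<Longrightarrow> card {u \<in> verts H. adj H v u \<and> r u < r v} \<le> m"
    using ranking_of_list[OF assms(1,3)] assms(2) distinct_card[OF assms(1)] by auto
  then have "ordering_bound H r (Suc m)" by (auto simp: ordering_bound_def)
  then show ?thesis unfolding col_def by (intro Least_le) blast
qed

lemma adj_total_graph:
  "adj (total_graph G) (Inl x) (Inl y) \<longleftrightarrow> adj G x y"
  "adj (total_graph G) (Inl x) (Inr e) \<longleftrightarrow> e \<in> edges G \<and> x \<in> e"
  "adj (total_graph G) (Inr e) (Inl x) \<longleftrightarrow> e \<in> edges G \<and> x \<in> e"
  "adj (total_graph G) (Inr e) (Inr f) \<longleftrightarrow> e \<in> edges G \<and> f \<in> edges G \<and> e \<noteq> f \<and> e \<inter> f \<noteq> {}"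
  by (auto simp: adj_def total_graph_def doubleton_eq_iff insert_commute)

lemma verts_total_graph: "verts (total_graph G) = Inl ` verts G \<union> Inr ` edges G"
  by (simp add: total_graph_def)

text \<open>The hypotheses in a form inherited by subgraphs: the fixed bound \<open>k\<close> on
  degrees stays valid when edges are deleted.\<close>

definition admissible :: "nat \<Rightarrow> 'a graph \<Rightarrow> bool" where
  "admissible k G \<longleftrightarrow> finite_simple_graph G \<and> planar G \<and> (\<forall>v\<in>verts G. degree G v \<le> k) \<and> \<not> (\<exists>c. is_net 5 G c)"

lemma admissible_subgraph:
  assumes "admissible k G" "finite_simple_graph G'" "verts G' \<subseteq> verts G" "edges G' \<subseteq> edges G"
  shows "admissible k G'"
proof -
  obtain p \<gamma> where "plane_drawing G p \<gamma>" using assms(1) by (auto simp: admissible_def planar_def)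
  then have "plane_drawing G' p \<gamma>"
    unfolding plane_drawing_def using assms(3,4) by (meson image_mono inj_on_subset inf_mono order_refl subset_iff subset_trans)
  moreover have "degree G' v \<le> k" if v: "v \<in> verts G'" for v
  proof -
    have "finite (verts G)" using assms(1) by (simp add: admissible_def finite_simple_graph_def)
    then have "degree G' v \<le> degree G v"
      unfolding degree_def using assms(3,4) by (intro card_mono) (auto simp: adj_def)
    then show ?thesis using assms(1,3) v by (force simp: admissible_def)
  qed
  moreover have "is_net 5 G c" if "is_net 5 G' c" for c
    using that assms(3,4) by (auto simp: is_net_def is_cycle_def is_chord_def)
  ultimately show ?thesis using assms(1,2) by (auto simp: admissible_def planar_def)
qed

text \<open>At a vertex of degree 1 or 2 any edge will do, since its other end has degree at most
  \<open>k\<close>. With minimum degree 3 a light edge has degree sum at most 9, which is where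
  \<open>k + 2\<close> needs \<open>k \<ge> 7\<close>.\<close>

lemma removable:
  assumes k: "7 \<le> k" and G: "admissible k G" "verts G \<noteq> {}"
  obtains u where "u \<in> verts G" "degree G u = 0"
  | u v where "{u, v} \<in> edges G" "degree G u \<le> 4" "degree G u + degree G v \<le> k + 2"
proof (cases "\<exists>u\<in>verts G. degree G u < 3")
  case True
  then obtain u where u: "u \<in> verts G" "degree G u < 3" by blast
  show ?thesis
  proof (cases "degree G u = 0")
    case True
    then show ?thesis using that(1) u by blast
  next
    case False
    then have "{v \<in> verts G. adj G u v} \<noteq> {}" by (metis card.empty degree_def)
    then obtain v where v: "v \<in> verts G" "{u, v} \<in> edges G" by (auto simp: adj_def)
    then have "degree G v \<le> k" using G(1) by (simp add: admissible_def)
    then show ?thesis using that(2)[OF v(2)] u(2) by simp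
  qed
next
  case False
  then obtain u v where "{u, v} \<in> edges G"
    "degree G u = 3 \<and> degree G v \<le> 6 \<or> degree G u = 4 \<and> degree G v \<le> 5"
    using light_edge[of G] G by (auto simp: admissible_def not_less)
  then show ?thesis using that(2)[of u v] k by auto
qed

lemma total_graph_list:
  assumes k: "7 \<le> k" and "admissible k G"
  shows "\<exists>xs. distinct xs \<and> set xs = verts (total_graph G) \<and> back_degree_le (adj (total_graph G)) (Suc k) xs"
  using assms(2)
proof (induction "card (verts G) + card (edges G)" arbitrary: G rule: less_induct)
  case less
  have fsg: "finite_simple_graph G" using less.prems by (simp add: admissible_def)
  have E: "e \<subseteq> verts G \<and> card e = 2" if "e \<in> edges G" for e
    using that fsg by (auto simp: finite_simple_graph_def)
  have finV: "finite (verts G)" using fsg by (simp add: finite_simple_graph_def)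
  have "edges G \<subseteq> Pow (verts G)" using E by blast
  then have finE: "finite (edges G)" using finV by (meson finite_Pow_iff finite_subset)
  show ?case
  proof (cases "verts G = {}")
    case True
    then have "edges G = {}" using E by fastforce
    then show ?thesis using True by (intro exI[of _ "[]"]) (simp add: verts_total_graph)
  next
    case False
    from k less.prems False show ?thesis
    proof (cases rule: removable)
      case (1 u)
      let ?G = "(verts G - {u}, edges G)"
      have nou: "u \<notin> e" if "e \<in> edges G" for e
      proof
        assume "u \<in> e"
        then have "card {e \<in> edges G. u \<in> e} \<noteq> 0" using that finE by auto
        then show False using 1(2) degree_edges[OF fsg] by simp
      qed
      have "finite_simple_graph ?G" using E nou finV by (auto simp: finite_simple_graph_def)
      then have "admissible k ?G" by (rule admissible_subgraph[OF less.prems]) auto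
      moreover have "card (verts ?G) + card (edges ?G) < card (verts G) + card (edges G)"
        using card_Diff1_less[OF finV 1(1)] by simp
      ultimately obtain xs where xs: "distinct xs" "set xs = verts (total_graph ?G)"
        "back_degree_le (adj (total_graph ?G)) (Suc k) xs" using less.hyps by blast
      have adj: "adj (total_graph ?G) = adj (total_graph G)"
        by (simp add: fun_eq_iff adj_def total_graph_def)
      have "{w \<in> set xs. adj (total_graph G) (Inl u) w} = {}"
        using nou xs(2) by (auto simp: verts_total_graph adj_total_graph) (auto simp: adj_def)
      then have "card {w \<in> set xs. adj (total_graph G) (Inl u) w} \<le> Suc k" by (simp only: card.empty)
      then have "back_degree_le (adj (total_graph G)) (Suc k) (Inl u # xs)"
        using xs(3) adj by simp
      moreover have "distinct (Inl u # xs)" "set (Inl u # xs) = verts (total_graph G)"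
        using xs(1,2) 1(1) by (auto simp: verts_total_graph)
      ultimately show ?thesis by blast
    next
      case (2 u v)
      let ?e = "{u, v}"
      let ?G = "(verts G, edges G - {?e})"
      let ?T = "adj (total_graph G)"
      have uv: "u \<noteq> v" "u \<in> verts G" "v \<in> verts G" using E[OF 2(1)] by auto
      have "finite_simple_graph ?G" using E finV by (auto simp: finite_simple_graph_def)
      then have "admissible k ?G" by (rule admissible_subgraph[OF less.prems]) auto
      moreover have "card (verts ?G) + card (edges ?G) < card (verts G) + card (edges G)"
        using card_Diff1_less[OF finE 2(1)] by simp
      ultimately obtain xs where xs: "distinct xs" "set xs = verts (total_graph ?G)"
        "back_degree_le (adj (total_graph ?G)) (Suc k) xs" using less.hyps by blast
      \<comment> \<open>The vertex \<open>u\<close> may stand anywhere in the old ordering, so it is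
        taken out and put at the very end. Removing it early cannot increase any back
        degree.\<close>
      define ys where "ys = filter (\<lambda>z. z \<noteq> Inl u) xs"
      have sys: "set ys = verts (total_graph ?G) - {Inl u}" using xs(2) by (auto simp: ys_def)
      \<comment> \<open>The two total graphs differ only in pairs containing the element
        \<open>uv\<close> and in the pair \<open>u\<close>, \<open>v\<close>. The list contains
        neither \<open>uv\<close> nor \<open>u\<close>, so adjacency on it is unchanged.\<close>
      have ys: "back_degree_le ?T (Suc k) ys"
      proof (rule back_degree_le_mono)
        show "back_degree_le (adj (total_graph ?G)) (Suc k) ys"
          unfolding ys_def by (rule back_degree_le_filter[OF xs(3)])
        fix x y assume xy: "x \<in> set ys" "y \<in> set ys" "?T x y"
        have l: "a \<noteq> u" if "Inl a \<in> set ys" for a using that sys by auto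
        have r: "e \<in> edges G - {?e}" if "Inr e \<in> set ys" for e
          using that sys by (auto simp: verts_total_graph)
        show "adj (total_graph ?G) x y"
        proof (cases x)
          case x: (Inl a)
          show ?thesis
          proof (cases y)
            case (Inl b)
            have "adj G a b" "a \<noteq> u" "b \<noteq> u" using xy x Inl l by (auto simp: adj_total_graph)
            then have "adj ?G a b" by (auto simp: adj_def doubleton_eq_iff)
            then show ?thesis unfolding x Inl adj_total_graph .
          next
            case (Inr f)
            then show ?thesis using xy x r[of f] by (simp add: adj_total_graph)
          qed
        next
          case x: (Inr e)
          show ?thesis
          proof (cases y)
            case (Inl b)
            then show ?thesis using xy x r[of e] by (simp add: adj_total_graph)
          next
            case (Inr f)
            then show ?thesis using xy x r[of e] r[of f] by (simp add: adj_total_graph)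
          qed
        qed
      qed
      have ce: "card ({e \<in> edges G. w \<in> e} - {?e}) = degree G w - 1" if "w \<in> {u, v}" for w
        using that 2(1) finE degree_edges[OF fsg, of w] by (simp add: card_Diff_singleton)
      \<comment> \<open>Both degrees are positive, so the truncated subtractions in the count for
        \<open>uv\<close> are genuine.\<close>
      have pos: "0 < degree G w" if "w \<in> {u, v}" for w
        using that 2(1) finE degree_edges[OF fsg, of w] by (auto simp: card_gt_0_iff)
      let ?S = "\<lambda>w. {e \<in> edges G. w \<in> e} - {?e}"
      \<comment> \<open>With \<open>u\<close> absent, the edge \<open>uv\<close> sees
        \<open>v\<close> and the other edges at its ends, in all at most
        \<open>degree G u + degree G v - 1\<close> elements.\<close>
      have "{w \<in> set ys. ?T (Inr ?e) w} \<subseteq> insert (Inl v) (Inr ` (?S u \<union> ?S v))"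
      proof
        fix w assume "w \<in> {w \<in> set ys. ?T (Inr ?e) w}"
        then show "w \<in> insert (Inl v) (Inr ` (?S u \<union> ?S v))"
          using sys by (cases w) (auto simp: adj_total_graph verts_total_graph)
      qed
      then have "card {w \<in> set ys. ?T (Inr ?e) w} \<le> card (insert (Inl v) (Inr ` (?S u \<union> ?S v)))"
        using finE by (intro card_mono) auto
      also have "\<dots> \<le> Suc (card (Inr ` (?S u \<union> ?S v) :: ('a + 'a set) set))"
        using finE by (simp add: card_insert_if)
      also have "card (Inr ` (?S u \<union> ?S v) :: ('a + 'a set) set) = card (?S u \<union> ?S v)"
        by (rule card_image) simp
      also have "\<dots> \<le> card (?S u) + card (?S v)" by (rule card_Un_le)
      also have "\<dots> = (degree G u - 1) + (degree G v - 1)" using ce by simp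
      finally have e_le: "card {w \<in> set ys. ?T (Inr ?e) w} \<le> Suc k"
        using 2(3) pos[of u] pos[of v] by simp
      \<comment> \<open>Placed last, \<open>u\<close> sees each neighbour and each incident edge
        once: at most 8 elements, and 8 is at most \<open>Suc k\<close>.\<close>
      have "{w \<in> set (Inr ?e # ys). ?T (Inl u) w}
        \<subseteq> Inl ` {x \<in> verts G. adj G u x} \<union> Inr ` {e \<in> edges G. u \<in> e}"
      proof
        fix w assume "w \<in> {w \<in> set (Inr ?e # ys). ?T (Inl u) w}"
        then show "w \<in> Inl ` {x \<in> verts G. adj G u x} \<union> Inr ` {e \<in> edges G. u \<in> e}"
          using sys by (cases w) (auto simp: adj_total_graph verts_total_graph)
      qed
      then have "card {w \<in> set (Inr ?e # ys). ?T (Inl u) w}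
        \<le> card (Inl ` {x \<in> verts G. adj G u x} \<union> Inr ` {e \<in> edges G. u \<in> e} :: ('a + 'a set) set)"
        using finE finV by (intro card_mono) auto
      also have "\<dots> \<le> card (Inl ` {x \<in> verts G. adj G u x} :: ('a + 'a set) set)
        + card (Inr ` {e \<in> edges G. u \<in> e} :: ('a + 'a set) set)" by (rule card_Un_le)
      also have "\<dots> = degree G u + degree G u"
        by (simp add: card_image degree_def degree_edges[OF fsg, of u, symmetric])
      finally have u_le: "card {w \<in> set (Inr ?e # ys). ?T (Inl u) w} \<le> Suc k" using 2(2) k by simp
      have "back_degree_le ?T (Suc k) (Inl u # Inr ?e # ys)" using ys e_le u_le by simp
      moreover have "distinct (Inl u # Inr ?e # ys)"
        using xs(1) sys by (auto simp: ys_def verts_total_graph)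
      moreover have "set (Inl u # Inr ?e # ys) = verts (total_graph G)"
        using sys 2(1) uv by (auto simp: verts_total_graph)
      ultimately show ?thesis by blast
    qed
  qed
qed

theorem theorem11:
  fixes k :: nat and G :: "'a graph"
  assumes "7 \<le> k"
    and "finite_simple_graph G"
    and "planar G"
    and "max_degree G \<le> k"
    and "\<not> (\<exists>c. is_net 5 G c)"
  shows "col (total_graph G) \<le> k + 2"
proof -
  have "degree G v \<le> k" if "v \<in> verts G" for v
  proof -
    have "finite (verts G)" using assms(2) by (simp add: finite_simple_graph_def)
    then have "degree G v \<le> max_degree G"
      unfolding max_degree_def using that by (intro Max_ge) auto
    then show ?thesis using assms(4) by simp
  qed
  then have "admissible k G" using assms by (simp add: admissible_def)
  then show ?thesis using total_graph_list[OF assms(1)] col_le by fastforce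
qed

end
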